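(* There is a randomised algorithm that, given the vertex set of a hidden connected $n$-vertex graph $G$ of maximum degree at most $\Delta$ and treelength at most $k$ together with access to a distance oracle for $G$, reconstructs $G$ using $O_{\Delta,k}(n \log^2 n)$ distance queries in expectation.
   Context: All graphs are simple, undirected and connected. In the distance query model, only the vertex set $V$ of a hidden graph $G=(V,E)$ is known; the algorithm may adaptively query an oracle which, given a pair $(u,v)\in V^2$, returns the shortest path distance $d_G(u,v)$. For a class $\mathcal{G}$ of connected graphs, an algorithm reconstructs the graphs in the class if for every $G\in\mathcal{G}$ the distance profile obtained from its queries is not compatible with any other graph in $\mathcal{G}$ (equivalently, it determines the edge set $E$). The query complexity of a randomised algorithm is the maximum over input graphs in the class of the expected number of queries (expectation over the algorithm's randomness). A tree decomposition of $G$ is a pair $(T,(B_t)_{t\in V(T)})$ where $T$ is a tree and $B_t\subseteq V(G)$, such that for every $v\in V(G)$ the set $\{t : v\in B_t\}$ is nonempty and induces a subtree of $T$, and every edge of $G$ is contained in some bag $B_t$. The treelength of $G$ is the minimum integer $k$ such that $G$ has a tree decomposition in which $d_G(u,v)\le k$ for all $u,v$ lying in a common bag (distances measured in the whole graph $G$). The notation $O_{\Delta,k}(f(n))$ means at most $g(\Delta,k)\,f(n)$ for some function $g$ depending only on $\Delta$ and $k$. *)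

theory Defs
  imports "HOL-Probability.Probability"
begin

text \<open>
  A finite simple undirected graph is given by its vertex set \<open>V\<close> and its set \<open>E\<close> of
  two-element edges.
\<close>

definition sgraph :: "'v set \<Rightarrow> 'v set set \<Rightarrow> bool" where
  "sgraph V E \<longleftrightarrow> finite V \<and> (\<forall>e\<in>E. e \<subseteq> V \<and> card e = 2)"

definition graph_path :: "'v set \<Rightarrow> 'v set set \<Rightarrow> 'v \<Rightarrow> 'v list \<Rightarrow> 'v \<Rightarrow> bool" where
  "graph_path V E u p v \<longleftrightarrow>
     p \<noteq> [] \<and> hd p = u \<and> last p = v \<and> set p \<subseteq> V \<and> distinct p \<and>
     successively (\<lambda>x y. {x, y} \<in> E) p"

definition graph_connected :: "'v set \<Rightarrow> 'v set set \<Rightarrow> bool" where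
  "graph_connected V E \<longleftrightarrow> V \<noteq> {} \<and> (\<forall>u\<in>V. \<forall>v\<in>V. \<exists>p. graph_path V E u p v)"

text \<open>
  The length of a path is its number of edges. The distance is only meaningful for vertices
  joined by some path; it is used for connected graphs only.
\<close>

definition graph_dist :: "'v set \<Rightarrow> 'v set set \<Rightarrow> 'v \<Rightarrow> 'v \<Rightarrow> nat" where
  "graph_dist V E u v = (LEAST l. \<exists>p. graph_path V E u p v \<and> length p = Suc l)"

definition graph_degree :: "'v set set \<Rightarrow> 'v \<Rightarrow> nat" where
  "graph_degree E v = card {e \<in> E. v \<in> e}"

definition max_degree :: "'v set \<Rightarrow> 'v set set \<Rightarrow> nat" where
  "max_degree V E = Max (graph_degree E ` V)"

definition graph_cycle :: "'v set \<Rightarrow> 'v set set \<Rightarrow> 'v list \<Rightarrow> bool" where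
  "graph_cycle V E c \<longleftrightarrow>
     length c \<ge> 3 \<and> set c \<subseteq> V \<and> distinct c \<and>
     successively (\<lambda>x y. {x, y} \<in> E) c \<and> {last c, hd c} \<in> E"

definition graph_tree :: "'v set \<Rightarrow> 'v set set \<Rightarrow> bool" where
  "graph_tree V E \<longleftrightarrow> sgraph V E \<and> graph_connected V E \<and> (\<nexists>c. graph_cycle V E c)"

definition induced_edges :: "'v set set \<Rightarrow> 'v set \<Rightarrow> 'v set set" where
  "induced_edges E S = {e \<in> E. e \<subseteq> S}"

text \<open>
  The tree of a tree decomposition is finite, so taking its nodes to be natural numbers
  loses nothing. Trees are nonempty by connectedness.
\<close>

definition tree_decomposition ::
  "'v set \<Rightarrow> 'v set set \<Rightarrow> nat set \<Rightarrow> nat set set \<Rightarrow> (nat \<Rightarrow> 'v set) \<Rightarrow> bool" where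
  "tree_decomposition V E N F B \<longleftrightarrow>
     graph_tree N F \<and>
     (\<forall>t\<in>N. B t \<subseteq> V) \<and>
     (\<forall>v\<in>V. {t \<in> N. v \<in> B t} \<noteq> {} \<and>
        graph_tree {t \<in> N. v \<in> B t} (induced_edges F {t \<in> N. v \<in> B t})) \<and>
     (\<forall>e\<in>E. \<exists>t\<in>N. e \<subseteq> B t)"

definition treelength :: "'v set \<Rightarrow> 'v set set \<Rightarrow> nat" where
  "treelength V E =
     (LEAST k. \<exists>N F B. tree_decomposition V E N F B \<and>
        (\<forall>t\<in>N. \<forall>u\<in>B t. \<forall>v\<in>B t. graph_dist V E u v \<le> k))"

definition bounded_treelength_graphs :: "nat \<Rightarrow> nat \<Rightarrow> 'v set \<Rightarrow> 'v set set set" where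
  "bounded_treelength_graphs \<Delta> k V =
     {E. sgraph V E \<and> graph_connected V E \<and> max_degree V E \<le> \<Delta> \<and> treelength V E \<le> k}"

text \<open>
  A randomised query algorithm interleaves adaptive queries, whose continuation depends on the
  oracle's answer, with random choices. It has no explicit output: what it learns is the list of
  queries with their answers. Being an element of an inductive datatype, it makes
  finitely many queries on every run. The set function \<open>query_set\<close> collects the queries at all
  nodes of the algorithm.
\<close>

datatype (query_set: 'q) query_alg =
    Stop
  | Query 'q "nat \<Rightarrow> 'q query_alg"
  | Randomise "'q query_alg pmf"

primrec transcript :: "('q \<Rightarrow> nat) \<Rightarrow> 'q query_alg \<Rightarrow> ('q \<times> nat) list pmf" where
  "transcript \<O> Stop = return_pmf []"
| "transcript \<O> (Query q f) = map_pmf (\<lambda>\<tau>. (q, \<O> q) # \<tau>) (transcript \<O> (f (\<O> q)))"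
| "transcript \<O> (Randomise p) = join_pmf (map_pmf (transcript \<O>) p)"

definition distance_oracle :: "'v set \<Rightarrow> 'v set set \<Rightarrow> 'v \<times> 'v \<Rightarrow> nat" where
  "distance_oracle V E = (\<lambda>(u, v). graph_dist V E u v)"

definition compatible :: "'v set \<Rightarrow> (('v \<times> 'v) \<times> nat) list \<Rightarrow> 'v set set \<Rightarrow> bool" where
  "compatible V \<tau> E \<longleftrightarrow> (\<forall>(q, a)\<in>set \<tau>. distance_oracle V E q = a)"

text \<open>
  Here \<open>\<G>\<close> is a class of graphs on the known vertex set \<open>V\<close>, given by their edge sets.
  Reconstruction is required for every outcome of the random choices.
\<close>

definition reconstructs ::
  "'v set \<Rightarrow> 'v set set set \<Rightarrow> ('v \<times> 'v) query_alg \<Rightarrow> bool" where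
  "reconstructs V \<G> A \<longleftrightarrow>
     (\<forall>E\<in>\<G>. \<forall>\<tau>\<in>set_pmf (transcript (distance_oracle V E) A).
        \<forall>E'\<in>\<G>. compatible V \<tau> E' \<longrightarrow> E' = E)"

definition query_complexity ::
  "'v set \<Rightarrow> 'v set set set \<Rightarrow> ('v \<times> 'v) query_alg \<Rightarrow> ennreal" where
  "query_complexity V \<G> A =
     (SUP E\<in>\<G>. \<integral>\<^sup>+\<tau>. of_nat (length \<tau>) \<partial>measure_pmf (transcript (distance_oracle V E) A))"

end

theory Submission
  imports Defs
begin

text \<open>
  A deterministic algorithm already succeeds, with \<open>O(n log n)\<close> queries. Query all distances
  from a fixed vertex \<open>v0\<close> and insert the vertices in order of their level. A vertex \<open>u\<close> of
  level \<open>i + 1\<close> finds a neighbour \<open>p\<close> in level \<open>i\<close> by binary search: bags have bounded size,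
  and by the Helly property of subtrees some bag is a balanced separator of the known graph on the
  levels up to \<open>i\<close>; the distances of \<open>u\<close> to this bag and its neighbours tell on which side a
  shortest path from \<open>v0\<close> to \<open>u\<close> ends. The other neighbours of \<open>u\<close> are then found locally:
  vertices of one level that are joined within the graph above that level are at distance at most
  \<open>3k\<close>, so it suffices to query the boundedly many vertices of level \<open>i\<close> close to \<open>p\<close> and
  their neighbours in level \<open>i + 1\<close>.
\<close>

section \<open>The Helly property of tree decompositions\<close>

definition adj :: "'a set set \<Rightarrow> 'a set \<Rightarrow> 'a rel" where
  "adj E A = {(x, y). x \<in> A \<and> y \<in> A \<and> {x, y} \<in> E}"

text \<open>Unlike \<open>graph_connected\<close>, this admits the empty set, so deleting a leaf
  from a one-vertex tree needs no special case.\<close>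

definition conn_in :: "'a set set \<Rightarrow> 'a set \<Rightarrow> bool" where
  "conn_in E A \<longleftrightarrow> (\<forall>x\<in>A. \<forall>y\<in>A. (x, y) \<in> (adj E A)\<^sup>*)"

lemma adj_mono: "E \<subseteq> E' \<Longrightarrow> A \<subseteq> A' \<Longrightarrow> adj E A \<subseteq> adj E' A'"
  by (auto simp: adj_def)

lemma adj_sym: "(x, y) \<in> adj E A \<Longrightarrow> (y, x) \<in> adj E A"
  by (auto simp: adj_def insert_commute)

lemma adj_rtrancl_sym: "(x, y) \<in> (adj E A)\<^sup>* \<Longrightarrow> (y, x) \<in> (adj E A)\<^sup>*"
  by (meson adj_sym sym_def sym_rtrancl)

text \<open>Relation powers describe walks by their number of edges. Dropping
  \<open>distinct\<close> makes concatenation free; \<open>relpow_path\<close> recovers paths from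
  walks.\<close>

lemma graph_path_relpow:
  "graph_path A E u p v \<Longrightarrow> (u, v) \<in> adj E A ^^ (length p - 1)"
proof (induction p arbitrary: u)
  case Nil
  then show ?case by (simp add: graph_path_def)
next
  case (Cons x p)
  show ?case
  proof (cases p)
    case Nil
    with Cons.prems show ?thesis by (auto simp: graph_path_def)
  next
    case (Cons y q)
    with Cons.prems have "graph_path A E y p v" and "(u, y) \<in> adj E A"
      by (auto simp: graph_path_def adj_def)
    from relpow_Suc_I2[OF this(2) Cons.IH[OF this(1)]] show ?thesis
      using Cons by simp
  qed
qed

lemma graph_connected_conn_in:
  assumes "graph_connected A (induced_edges E A)"
  shows "conn_in E A"
  unfolding conn_in_def
proof (intro ballI)
  fix x y assume "x \<in> A" "y \<in> A"
  with assms obtain p where "graph_path A (induced_edges E A) x p y"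
    unfolding graph_connected_def by blast
  from graph_path_relpow[OF this]
  have "(x, y) \<in> (adj (induced_edges E A) A)\<^sup>*"
    by (rule relpow_imp_rtrancl)
  moreover have "adj (induced_edges E A) A \<subseteq> adj E A"
    by (intro adj_mono) (auto simp: induced_edges_def)
  ultimately show "(x, y) \<in> (adj E A)\<^sup>*"
    using rtrancl_mono by blast
qed

lemma conn_in_star:
  assumes "r \<in> A" "\<And>x. x \<in> A \<Longrightarrow> (r, x) \<in> (adj E A)\<^sup>*"
  shows "conn_in E A"
  unfolding conn_in_def using assms by (meson adj_rtrancl_sym rtrancl_trans)

text \<open>On a longest path, a neighbour of the first vertex \<open>l\<close> off the path would
  extend it, and a neighbour beyond the second vertex would close a cycle. If the path is only
  \<open>l\<close>, then \<open>l'\<close> is an unspecified \<open>hd []\<close>, but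
  \<open>l\<close> has no neighbours in \<open>N\<close>.\<close>

lemma acyclic_leaf:
  assumes fin: "finite N" and ne: "N \<noteq> {}" and cyc: "\<nexists>c. graph_cycle N F c"
    and irr: "\<And>x. {x} \<notin> F"
  obtains l l' where "l \<in> N" "\<And>x. x \<in> N \<Longrightarrow> {l, x} \<in> F \<Longrightarrow> x = l'"
proof -
  define P where "P p \<longleftrightarrow> p \<noteq> [] \<and> set p \<subseteq> N \<and> distinct p \<and>
    successively (\<lambda>x y. {x, y} \<in> F) p" for p
  obtain a where "a \<in> N" using ne by blast
  then have a: "P [a]" by (simp add: P_def)
  have "\<forall>p. P p \<longrightarrow> length p < Suc (card N)"
    by (auto simp: P_def less_Suc_eq_le distinct_card[symmetric] intro: card_mono fin)
  then obtain p where p: "P p" and mx: "\<And>q. P q \<Longrightarrow> length q \<le> length p"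
    using ex_has_greatest_nat[of P "[a]" length "Suc (card N)"] a by blast
  obtain l ps where lps: "p = l # ps" using p by (cases p) (auto simp: P_def)
  have "x = hd ps" if x: "x \<in> N" "{l, x} \<in> F" for x
  proof -
    have "x \<noteq> l" using x irr by auto
    have "x \<in> set ps"
    proof (rule ccontr)
      assume "x \<notin> set ps"
      then have "P (x # p)" using p x \<open>x \<noteq> l\<close>
        by (auto simp: P_def lps insert_commute)
      from mx[OF this] show False by simp
    qed
    then obtain as bs where ps: "ps = as @ x # bs" by (meson split_list)
    have "as = []"
    proof (rule ccontr)
      assume "as \<noteq> []"
      moreover have "successively (\<lambda>x y. {x, y} \<in> F) ((l # as @ [x]) @ bs)"
        using p by (simp add: P_def lps ps)
      then have "successively (\<lambda>x y. {x, y} \<in> F) (l # as @ [x])"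
        by (simp only: successively_append_iff)
      ultimately have "graph_cycle N F (l # as @ [x])"
        using p x unfolding graph_cycle_def P_def lps ps
        by (cases as) (auto simp: insert_commute)
      with cyc show False by blast
    qed
    then show ?thesis by (simp add: ps)
  qed
  moreover have "l \<in> N" using p by (simp add: P_def lps)
  ultimately show thesis using that by blast
qed

text \<open>Retract \<open>l\<close> onto its only possible neighbour \<open>l'\<close>: edges at
  \<open>l\<close> collapse and all others survive, so a walk between other vertices is mapped to
  one that avoids \<open>l\<close>.\<close>

lemma conn_in_remove_leaf:
  assumes irr: "\<And>x. {x} \<notin> F" and leaf: "\<And>x. x \<in> A \<Longrightarrow> {l, x} \<in> F \<Longrightarrow> x = l'"
    and c: "conn_in F A"
  shows "conn_in F (A - {l})"
  unfolding conn_in_def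
proof (intro ballI)
  fix x y assume x: "x \<in> A - {l}" and y: "y \<in> A - {l}"
  define f where "f z = (if z = l then l' else z)" for z
  have step: "(f a, f b) \<in> (adj F (A - {l}))\<^sup>*" if ab: "(a, b) \<in> adj F A" for a b
  proof (cases "a = l \<or> b = l")
    case True
    then have "f a = f b"
      using ab irr leaf unfolding adj_def f_def by (auto simp: insert_commute)
    then show ?thesis by simp
  next
    case False
    with ab show ?thesis by (auto simp: f_def adj_def)
  qed
  have "(x, y) \<in> (adj F A)\<^sup>*" using c x y by (auto simp: conn_in_def)
  then have "(f x, f y) \<in> (adj F (A - {l}))\<^sup>*"
    by induction (auto dest: step intro: rtrancl_trans)
  with x y show "(x, y) \<in> (adj F (A - {l}))\<^sup>*" by (auto simp: f_def)
qed

text \<open>Induction on \<open>N\<close>, deleting a leaf \<open>l\<close>. If \<open>{l}\<close>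
  is a member, every member meets it, so \<open>l\<close> is common to all. Otherwise a member
  containing \<open>l\<close> has a further vertex and hence contains \<open>l'\<close>, so members
  meeting in \<open>l\<close> also meet in \<open>l'\<close> and the intersections survive the
  deletion.\<close>

lemma subtree_helly:
  assumes "finite N" "N \<noteq> {}" "\<nexists>c. graph_cycle N F c" "\<And>x. {x} \<notin> F"
    and "\<And>A. A \<in> \<A> \<Longrightarrow> A \<subseteq> N \<and> conn_in F A"
    and "\<And>A B. A \<in> \<A> \<Longrightarrow> B \<in> \<A> \<Longrightarrow> A \<inter> B \<noteq> {}"
  shows "\<exists>t\<in>N. \<forall>A\<in>\<A>. t \<in> A"
  using assms
proof (induction N arbitrary: \<A> rule: finite_psubset_induct)
  case (psubset N)
  note irr = psubset.prems(3) and sub = psubset.prems(4) and int = psubset.prems(5)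
  obtain l l' where l: "l \<in> N" and leaf: "\<And>x. x \<in> N \<Longrightarrow> {l, x} \<in> F \<Longrightarrow> x = l'"
    using acyclic_leaf[OF psubset.hyps(1) psubset.prems(1,2,3)] by blast
  show ?case
  proof (cases "\<A> = {} \<or> {l} \<in> \<A>")
    case True
    then show ?thesis using l int[of "{l}"] by blast
  next
    case False
    have other: "\<exists>a\<in>A. a \<noteq> l" if "A \<in> \<A>" for A
      using int[OF that that] False that
      by (metis Int_absorb ex_in_conv insertI1 singletonD subsetI subset_antisym subset_singletonD)
    have nb: "l' \<in> A \<and> l' \<noteq> l" if A: "A \<in> \<A>" "l \<in> A" for A
    proof -
      obtain a where "a \<in> A" "a \<noteq> l" using other A by blast
      then have "(l, a) \<in> (adj F A)\<^sup>*" using sub A by (auto simp: conn_in_def)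
      then obtain b where b: "(l, b) \<in> adj F A"
        using \<open>a \<noteq> l\<close> by (cases rule: converse_rtranclE) auto
      then have "b = l'" using leaf sub[OF A(1)] by (auto simp: adj_def)
      with b irr show ?thesis by (auto simp: adj_def)
    qed
    let ?\<A> = "(\<lambda>A. A - {l}) ` \<A>"
    have "\<exists>t\<in>N - {l}. \<forall>A\<in>?\<A>. t \<in> A"
    proof (rule psubset.IH)
      show "N - {l} \<subset> N" using l by blast
      show "N - {l} \<noteq> {}" using False other sub by blast
      show "\<nexists>c. graph_cycle (N - {l}) F c"
        using psubset.prems(2) by (auto simp: graph_cycle_def)
      show "A \<subseteq> N - {l} \<and> conn_in F A" if A: "A \<in> ?\<A>" for A
      proof -
        obtain A' where A': "A' \<in> \<A>" "A = A' - {l}" using A by blast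
        have "conn_in F (A' - {l})"
          by (rule conn_in_remove_leaf[where l' = l']) (use irr sub A' leaf in auto)
        then show ?thesis using A' sub by blast
      qed
      show "A \<inter> B \<noteq> {}" if AB: "A \<in> ?\<A>" "B \<in> ?\<A>" for A B
      proof -
        obtain A' B' where A': "A' \<in> \<A>" "A = A' - {l}" and B': "B' \<in> \<A>" "B = B' - {l}"
          using AB by blast
        then obtain z where z: "z \<in> A'" "z \<in> B'" using int by blast
        show ?thesis
        proof (cases "z = l")
          case True
          then show ?thesis using nb A' B' z by blast
        qed (use A' B' z in blast)
      qed
    qed (use irr in blast)
    then obtain t where "t \<in> N" "\<And>A. A \<in> \<A> \<Longrightarrow> t \<in> A - {l}" by auto
    then show ?thesis by auto
  qed
qed

text \<open>The nodes whose bags contain a fixed vertex form a subtree, and consecutive vertices of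
  a walk in \<open>Q\<close> share a bag, so their subtrees meet.\<close>

lemma tree_decomposition_conn_in:
  assumes td: "tree_decomposition V E N F B" and Q: "Q \<subseteq> V" "conn_in E Q"
  shows "conn_in F {t \<in> N. B t \<inter> Q \<noteq> {}}"
proof -
  let ?T = "{t \<in> N. B t \<inter> Q \<noteq> {}}"
  have same: "(s, t) \<in> (adj F ?T)\<^sup>*"
    if "x \<in> Q" "s \<in> N" "t \<in> N" "x \<in> B s" "x \<in> B t" for x s t
  proof -
    have "x \<in> V" using that(1) Q by blast
    with td have "graph_tree {t \<in> N. x \<in> B t} (induced_edges F {t \<in> N. x \<in> B t})"
      by (simp add: tree_decomposition_def)
    then have "conn_in F {t \<in> N. x \<in> B t}"
      unfolding graph_tree_def by (intro graph_connected_conn_in) simp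
    then have "(s, t) \<in> (adj F {t \<in> N. x \<in> B t})\<^sup>*"
      using that by (auto simp: conn_in_def)
    moreover have "adj F {t \<in> N. x \<in> B t} \<subseteq> adj F ?T"
      by (rule adj_mono) (use that in auto)
    ultimately show ?thesis using rtrancl_mono by blast
  qed
  show ?thesis
    unfolding conn_in_def
  proof (intro ballI)
    fix s t assume "s \<in> ?T" "t \<in> ?T"
    then obtain x y where x: "x \<in> Q" "x \<in> B s" "s \<in> N" and y: "y \<in> Q" "y \<in> B t" "t \<in> N"
      by blast
    have "(x, y) \<in> (adj E Q)\<^sup>*" using Q x y by (auto simp: conn_in_def)
    then show "(s, t) \<in> (adj F ?T)\<^sup>*" using y
    proof (induction arbitrary: t)
      case base
      then show ?case using same[OF x(1,3) base(3) x(2) base(2)] by simp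
    next
      case (step y z)
      from step.hyps(2) have "{y, z} \<in> E" by (simp add: adj_def)
      moreover have "\<forall>e\<in>E. \<exists>t\<in>N. e \<subseteq> B t"
        using td by (simp add: tree_decomposition_def)
      ultimately obtain b where "b \<in> N" "{y, z} \<subseteq> B b"
        by blast
      then have b: "b \<in> N" "y \<in> B b" "z \<in> B b" by simp_all
      have "(s, b) \<in> (adj F ?T)\<^sup>*"
        using step.hyps(2) b by (intro step.IH) (simp_all add: adj_def)
      moreover have "(b, t) \<in> (adj F ?T)\<^sup>*"
        by (rule same[OF step.prems(1) b(1) step.prems(3) b(3) step.prems(2)])
      ultimately show ?case by (rule rtrancl_trans)
    qed
  qed
qed

text \<open>Pairwise intersection passes to the sets of nodes: a common vertex of two sets lies in
  some bag, and its node belongs to both. Then \<open>subtree_helly\<close> applies.\<close>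

lemma tree_decomposition_helly:
  assumes td: "tree_decomposition V E N F B"
    and K: "\<And>K. K \<in> \<K> \<Longrightarrow> K \<subseteq> V \<and> conn_in E K"
    and int: "\<And>K K'. K \<in> \<K> \<Longrightarrow> K' \<in> \<K> \<Longrightarrow> K \<inter> K' \<noteq> {}"
  shows "\<exists>t\<in>N. \<forall>K\<in>\<K>. B t \<inter> K \<noteq> {}"
proof -
  let ?\<A> = "(\<lambda>K. {t \<in> N. B t \<inter> K \<noteq> {}}) ` \<K>"
  have tree: "graph_tree N F" using td by (simp add: tree_decomposition_def)
  have "\<exists>t\<in>N. \<forall>A\<in>?\<A>. t \<in> A"
  proof (rule subtree_helly)
    show "finite N" "N \<noteq> {}" "\<nexists>c. graph_cycle N F c"
      using tree by (auto simp: graph_tree_def sgraph_def graph_connected_def)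
    show "{x} \<notin> F" for x
      using tree by (force simp: graph_tree_def sgraph_def)
    show "A \<subseteq> N \<and> conn_in F A" if "A \<in> ?\<A>" for A
      using that K tree_decomposition_conn_in[OF td] by blast
    show "A \<inter> A' \<noteq> {}" if AA: "A \<in> ?\<A>" "A' \<in> ?\<A>" for A A'
    proof -
      obtain K1 K2 where K12: "K1 \<in> \<K>" "K2 \<in> \<K>"
        and AB: "A = {t \<in> N. B t \<inter> K1 \<noteq> {}}" "A' = {t \<in> N. B t \<inter> K2 \<noteq> {}}"
        using AA by blast
      obtain x where x: "x \<in> K1" "x \<in> K2" using int K12 by blast
      have "x \<in> V" using K K12 x by blast
      with td have "{t \<in> N. x \<in> B t} \<noteq> {}" by (simp add: tree_decomposition_def)
      then obtain t where "t \<in> N" "x \<in> B t" by blast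
      then show ?thesis using AB x by blast
    qed
  qed
  then show ?thesis by auto
qed

section \<open>Distances in connected graphs\<close>

locale cgraph =
  fixes V :: "'v set" and E :: "'v set set"
  assumes sg: "sgraph V E" and cn: "graph_connected V E"
begin

abbreviation d :: "'v \<Rightarrow> 'v \<Rightarrow> nat" where "d \<equiv> graph_dist V E"

lemma finV: "finite V" using sg by (simp add: sgraph_def)

lemma edgeD: "{x, y} \<in> E \<Longrightarrow> x \<in> V \<and> y \<in> V \<and> x \<noteq> y"
  using sg by (force simp: sgraph_def)

lemma adjV: "(x, y) \<in> adj E V \<longleftrightarrow> {x, y} \<in> E"
  using edgeD by (auto simp: adj_def)

text \<open>If the start \<open>u\<close> recurs on the path obtained for the rest of the walk, only
  the part from \<open>u\<close> on is kept; hence the inequality for the length.\<close>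

lemma relpow_path:
  assumes "(u, v) \<in> adj E V ^^ l" "u \<in> V"
  shows "\<exists>p. graph_path V E u p v \<and> length p \<le> Suc l"
  using assms
proof (induction l arbitrary: u)
  case 0
  then have "graph_path V E u [u] v" by (auto simp: graph_path_def)
  then show ?case by (intro exI[of _ "[u]"]) auto
next
  case (Suc l)
  then obtain w where w: "(u, w) \<in> adj E V" "(w, v) \<in> adj E V ^^ l"
    by (meson relpow_Suc_D2)
  then obtain p where p: "graph_path V E w p v" "length p \<le> Suc l"
    using Suc.IH[of w] by (auto simp: adj_def)
  show ?case
  proof (cases "u \<in> set p")
    case False
    then have "graph_path V E u (u # p) v"
      using p w Suc.prems by (auto simp: graph_path_def successively_Cons adj_def)
    with p show ?thesis by (intro exI[of _ "u # p"]) auto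
  next
    case True
    then obtain as bs where "p = as @ u # bs" by (meson split_list)
    then have "graph_path V E u (u # bs) v" "length (u # bs) \<le> Suc (Suc l)"
      using p by (auto simp: graph_path_def successively_append_iff)
    then show ?thesis by blast
  qed
qed

lemma dist_le: "(u, v) \<in> adj E V ^^ l \<Longrightarrow> u \<in> V \<Longrightarrow> d u v \<le> l"
proof -
  assume "(u, v) \<in> adj E V ^^ l" "u \<in> V"
  then obtain p where p: "graph_path V E u p v" "length p \<le> Suc l"
    using relpow_path by blast
  have "p \<noteq> []" using p by (simp add: graph_path_def)
  then have "length p = Suc (length p - 1)" by simp
  then have "d u v \<le> length p - 1"
    unfolding graph_dist_def using p by (intro Least_le) blast
  with p show ?thesis by linarith
qed

lemma dist_relpow: assumes "u \<in> V" "v \<in> V" shows "(u, v) \<in> adj E V ^^ d u v"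
proof -
  obtain p where p: "graph_path V E u p v"
    using cn assms by (auto simp: graph_connected_def)
  have "p \<noteq> []" using p by (simp add: graph_path_def)
  then have "length p = Suc (length p - 1)" by simp
  then have "\<exists>l p. graph_path V E u p v \<and> length p = Suc l" using p by blast
  then have "\<exists>p. graph_path V E u p v \<and> length p = Suc (d u v)"
    unfolding graph_dist_def by (rule LeastI_ex)
  then show ?thesis using graph_path_relpow by fastforce
qed

lemma relpow_sym: "(u, v) \<in> adj E V ^^ l \<Longrightarrow> (v, u) \<in> adj E V ^^ l"
proof (induction l arbitrary: u)
  case (Suc l)
  then obtain w where w: "(u, w) \<in> adj E V" "(w, v) \<in> adj E V ^^ l"
    by (meson relpow_Suc_D2)
  show ?case using relpow_Suc_I[OF Suc.IH[OF w(2)] adj_sym[OF w(1)]] .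
qed auto

lemma dist_sym: "u \<in> V \<Longrightarrow> v \<in> V \<Longrightarrow> d u v = d v u"
  by (simp add: antisym dist_le dist_relpow relpow_sym)

lemma dist_triangle: "u \<in> V \<Longrightarrow> v \<in> V \<Longrightarrow> w \<in> V \<Longrightarrow> d u w \<le> d u v + d v w"
  by (meson dist_le dist_relpow relpow_trans)

lemma dist_refl [simp]: "u \<in> V \<Longrightarrow> d u u = 0"
  using dist_le[of u u 0] by simp

lemma dist_0: "u \<in> V \<Longrightarrow> v \<in> V \<Longrightarrow> d u v = 0 \<longleftrightarrow> u = v"
  using dist_relpow[of u v] by auto

lemma dist_edge: "{x, y} \<in> E \<Longrightarrow> d x y = 1"
  using dist_le[of x y 1] dist_0[of x y] edgeD[of x y] adjV by force

lemma dist_1: "u \<in> V \<Longrightarrow> v \<in> V \<Longrightarrow> d u v = 1 \<longleftrightarrow> {u, v} \<in> E"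
  using dist_relpow[of u v] dist_edge adjV by auto

lemma dist_step:
  assumes "u \<in> V" "v \<in> V" "d u v = Suc l"
  obtains w where "w \<in> V" "{u, w} \<in> E" "d w v = l"
proof -
  obtain w where w: "(u, w) \<in> adj E V" "(w, v) \<in> adj E V ^^ l"
    using dist_relpow[of u v] assms relpow_Suc_D2 by metis
  have e: "{u, w} \<in> E" "w \<in> V" using w adjV edgeD by auto
  have "d w v \<le> l" using dist_le w e by blast
  moreover have "Suc l \<le> 1 + d w v"
    using dist_triangle[of u w v] dist_edge e assms by auto
  ultimately show thesis using that e by simp
qed

text \<open>From \<open>x\<close> in the interval take a neighbour one step nearer to
  \<open>a\<close>. By the triangle inequality it is on a geodesic too, so repeating this leads to
  \<open>a\<close> inside the interval.\<close>

lemma interval_conn_in: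
  assumes "a \<in> V" "v \<in> V"
  shows "conn_in E {x \<in> V. d a x + d x v = d a v}" (is "conn_in E ?I")
proof (rule conn_in_star)
  show "a \<in> ?I" using assms by simp
  fix x assume "x \<in> ?I"
  then show "(a, x) \<in> (adj E ?I)\<^sup>*"
  proof (induction "d x a" arbitrary: x)
    case 0
    then show ?case using assms dist_0 by auto
  next
    case (Suc l)
    then obtain w where w: "w \<in> V" "{x, w} \<in> E" "d w a = l"
      using dist_step[of x a l] assms by auto
    have "d w v \<le> 1 + d x v"
      using dist_triangle[of w x v] dist_edge[of x w] dist_sym w Suc assms by auto
    moreover have "d a v \<le> d a w + d w v"
      using dist_triangle w assms by blast
    moreover have "d a w = l" "d a x = Suc l" using w Suc assms dist_sym by auto
    ultimately have "w \<in> ?I" using w Suc by auto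
    moreover have "(w, x) \<in> adj E ?I"
      using calculation w Suc by (auto simp: adj_def insert_commute)
    ultimately show ?case using Suc.hyps(1)[of w] w by (auto intro: rtrancl_into_rtrancl)
  qed
qed

lemma card_neighbours:
  assumes "x \<in> V" "max_degree V E \<le> \<Delta>"
  shows "card {y \<in> V. {x, y} \<in> E} \<le> \<Delta>"
proof -
  have "finite E" using sg finV by (auto simp: sgraph_def intro: finite_subset[of E "Pow V"])
  have "card {y \<in> V. {x, y} \<in> E} = card ((\<lambda>y. {x, y}) ` {y \<in> V. {x, y} \<in> E})"
    by (rule card_image[symmetric]) (auto simp: inj_on_def doubleton_eq_iff)
  also have "\<dots> \<le> card {e \<in> E. x \<in> e}"
    by (rule card_mono) (use \<open>finite E\<close> in auto)
  also have "\<dots> \<le> max_degree V E"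
    unfolding max_degree_def graph_degree_def
    by (rule Max_ge) (use finV assms in auto)
  finally show ?thesis using assms by simp
qed

text \<open>The ball of radius \<open>Suc r\<close> is covered by the closed neighbourhoods of the
  points in the ball of radius \<open>r\<close>, each of at most \<open>Suc \<Delta>\<close>
  vertices.\<close>

lemma card_ball:
  assumes "max_degree V E \<le> \<Delta>" "x \<in> V"
  shows "card {y \<in> V. d x y \<le> r} \<le> Suc \<Delta> ^ r"
proof (induction r)
  case 0
  have "{y \<in> V. d x y \<le> 0} = {x}" using dist_0 assms by auto
  then show ?case by simp
next
  case (Suc r)
  let ?B = "{y \<in> V. d x y \<le> r}"
  have "{y \<in> V. d x y \<le> Suc r} \<subseteq> (\<Union>y\<in>?B. insert y {z \<in> V. {y, z} \<in> E})"
  proof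
    fix z assume z: "z \<in> {y \<in> V. d x y \<le> Suc r}"
    show "z \<in> (\<Union>y\<in>?B. insert y {z \<in> V. {y, z} \<in> E})"
    proof (cases "d x z \<le> r")
      case False
      then have "d z x = Suc r" using z dist_sym assms by auto
      then obtain w where "w \<in> V" "{z, w} \<in> E" "d w x = r"
        using dist_step z assms by blast
      then show ?thesis using z dist_sym[of w x] assms by (auto simp: insert_commute)
    qed (use z in auto)
  qed
  then have "card {y \<in> V. d x y \<le> Suc r} \<le> card (\<Union>y\<in>?B. insert y {z \<in> V. {y, z} \<in> E})"
    by (intro card_mono) (use finV in auto)
  also have "\<dots> \<le> (\<Sum>y\<in>?B. card (insert y {z \<in> V. {y, z} \<in> E}))"
    by (rule card_UN_le) (use finV in auto)
  also have "\<dots> \<le> (\<Sum>y\<in>?B. Suc \<Delta>)"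
    by (rule sum_mono)
      (use card_neighbours assms finV in \<open>auto intro: order.trans[OF card_insert_le_m1] simp: card_insert_if le_SucI\<close>)
  also have "\<dots> = Suc \<Delta> * card ?B" by simp
  also have "\<dots> \<le> Suc \<Delta> * Suc \<Delta> ^ r" using Suc by (intro mult_le_mono2)
  also have "\<dots> = Suc \<Delta> ^ Suc r" by simp
  finally show ?case .
qed

end

section \<open>Graphs of bounded treelength\<close>

context cgraph
begin

text \<open>The single bag \<open>V\<close> shows that some width is possible, so the
  \<open>LEAST\<close> in \<open>treelength\<close> is attained by a decomposition.\<close>

lemma trivial_tree_decomposition: "tree_decomposition V E {0} {} (\<lambda>_. V)"
proof -
  have "graph_path {0} {} (0::nat) [0] 0" by (simp add: graph_path_def)
  then have c: "graph_connected {0::nat} {}"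
    by (auto simp: graph_connected_def)
  have "\<not> graph_cycle {0::nat} {} c" for c
    by (auto simp: graph_cycle_def)
  with c have t: "graph_tree {0::nat} {}"
    by (auto simp: graph_tree_def sgraph_def)
  have "{t. t = (0::nat) \<and> v \<in> V} = {0}" if "v \<in> V" for v
    using that by auto
  then show ?thesis
    using t sg by (auto simp: tree_decomposition_def induced_edges_def sgraph_def)
qed

lemma treelength_decomposition:
  assumes "treelength V E \<le> k"
  obtains N F B where "tree_decomposition V E N F B"
    "\<And>t u v. t \<in> N \<Longrightarrow> u \<in> B t \<Longrightarrow> v \<in> B t \<Longrightarrow> d u v \<le> k"
proof -
  let ?P = "\<lambda>k. \<exists>N F B. tree_decomposition V E N F B \<and>
    (\<forall>t\<in>N. \<forall>u\<in>B t. \<forall>v\<in>B t. d u v \<le> k)"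
  have "?P (Max ((\<lambda>(u, v). d u v) ` (V \<times> V)))"
    using trivial_tree_decomposition finV
    by (intro exI conjI) (auto intro!: Max_ge)
  then have "?P (treelength V E)"
    unfolding treelength_def by (rule LeastI)
  then show thesis using that assms by (meson order_trans)
qed

text \<open>Two connected sets that each hold more than half of \<open>Y\<close> intersect. The
  Helly property gives a bag meeting all of them, so a connected set avoiding this bag holds at most
  half. Distances within a bag are at most \<open>k\<close>, so it fits into a ball of radius
  \<open>k\<close>.\<close>

lemma balanced_separator:
  assumes deg: "max_degree V E \<le> \<Delta>" and tl: "treelength V E \<le> k" and fY: "finite Y"
  obtains S where "S \<subseteq> V" "card S \<le> Suc \<Delta> ^ k"
    "\<And>K. K \<subseteq> V \<Longrightarrow> conn_in E K \<Longrightarrow> K \<inter> S = {} \<Longrightarrow> 2 * card (K \<inter> Y) \<le> card Y"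
proof -
  obtain N F B where td: "tree_decomposition V E N F B"
    and B: "\<And>t u v. t \<in> N \<Longrightarrow> u \<in> B t \<Longrightarrow> v \<in> B t \<Longrightarrow> d u v \<le> k"
    using treelength_decomposition[OF tl] by blast
  let ?K = "{K. K \<subseteq> V \<and> conn_in E K \<and> card Y < 2 * card (K \<inter> Y)}"
  have "\<exists>t\<in>N. \<forall>K\<in>?K. B t \<inter> K \<noteq> {}"
  proof (rule tree_decomposition_helly[OF td])
    fix K L assume K: "K \<in> ?K" "L \<in> ?K"
    show "K \<inter> L \<noteq> {}"
    proof
      assume "K \<inter> L = {}"
      then have "card (K \<inter> Y) + card (L \<inter> Y) = card ((K \<inter> Y) \<union> (L \<inter> Y))"
        using fY by (intro card_Un_disjoint[symmetric]) auto
      also have "\<dots> \<le> card Y" by (intro card_mono fY) auto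
      finally show False using K by auto
    qed
  qed blast
  then obtain t where t: "t \<in> N" "\<And>K. K \<in> ?K \<Longrightarrow> B t \<inter> K \<noteq> {}" by auto
  have BV: "B t \<subseteq> V" using td t by (simp add: tree_decomposition_def)
  show thesis
  proof (rule that[OF BV])
    show "card (B t) \<le> Suc \<Delta> ^ k"
    proof (cases "B t = {}")
      case False
      then obtain x where x: "x \<in> B t" by blast
      have "card (B t) \<le> card {y \<in> V. d x y \<le> k}"
        using x B t BV finV by (intro card_mono) auto
      also have "\<dots> \<le> Suc \<Delta> ^ k" using card_ball deg x BV by blast
      finally show ?thesis .
    qed simp
    show "2 * card (K \<inter> Y) \<le> card Y" if "K \<subseteq> V" "conn_in E K" "K \<inter> B t = {}" for K
      using t(2)[of K] that by fastforce
  qed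
qed

text \<open>
  Some bag meets three pairwise intersecting connected sets: the component of \<open>a\<close> in the graph
  above its level, and the geodesic intervals from \<open>a\<close> and from \<open>b\<close> down to \<open>v\<close>. Its points in
  the intervals cannot be far below the level of \<open>a\<close>.
\<close>
lemma upper_component_dist:
  assumes tl: "treelength V E \<le> k" and v: "v \<in> V" and U: "U = {x \<in> V. d v a \<le> d v x}"
    and ab: "(a, b) \<in> (adj E U)\<^sup>*" and a: "a \<in> V" and lev: "d v b = d v a"
  shows "d a b \<le> 3 * k"
proof -
  obtain N F B where td: "tree_decomposition V E N F B"
    and B: "\<And>t u v. t \<in> N \<Longrightarrow> u \<in> B t \<Longrightarrow> v \<in> B t \<Longrightarrow> d u v \<le> k"
    using treelength_decomposition[OF tl] by blast
  define Q where "Q = {x. (a, x) \<in> (adj E U)\<^sup>*}"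
  have QU: "Q \<subseteq> U"
  proof
    fix x assume "x \<in> Q"
    then have "(a, x) \<in> (adj E U)\<^sup>*" by (simp add: Q_def)
    then show "x \<in> U" using a U by cases (auto simp: adj_def)
  qed
  then have b: "b \<in> V" using ab U by (auto simp: Q_def)
  have Qc: "conn_in E Q"
  proof (rule conn_in_star)
    show "a \<in> Q" by (simp add: Q_def)
    fix x assume "x \<in> Q"
    then have "(a, x) \<in> (adj E U)\<^sup>*" by (simp add: Q_def)
    then show "(a, x) \<in> (adj E Q)\<^sup>*"
    proof induction
      case (step y z)
      then have "(y, z) \<in> adj E Q"
        by (auto simp: Q_def adj_def intro: rtrancl_into_rtrancl)
      then show ?case using step.IH by (rule rtrancl_into_rtrancl[rotated])
    qed simp
  qed
  define I where "I c = {x \<in> V. d c x + d x v = d c v}" for c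
  let ?K = "{Q, I a, I b}"
  have mem: "a \<in> Q" "b \<in> Q" "a \<in> I a" "b \<in> I b" "v \<in> I a" "v \<in> I b"
    using a b v ab by (auto simp: Q_def I_def)
  have "\<exists>t\<in>N. \<forall>K\<in>?K. B t \<inter> K \<noteq> {}"
  proof (rule tree_decomposition_helly[OF td])
    show "K \<subseteq> V \<and> conn_in E K" if "K \<in> ?K" for K
      using that Qc QU U interval_conn_in[OF a v] interval_conn_in[OF b v]
      by (auto simp: I_def)
    show "K \<inter> L \<noteq> {}" if "K \<in> ?K" "L \<in> ?K" for K L
      using that mem by blast
  qed
  then obtain t q x y where t: "t \<in> N" and q: "q \<in> B t" "q \<in> Q"
    and x: "x \<in> B t" "x \<in> I a" and y: "y \<in> B t" "y \<in> I b" by auto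
  have V: "q \<in> V" "x \<in> V" "y \<in> V" using q QU U x y by (auto simp: I_def)
  \<comment> \<open>As \<open>z\<close> lies on a geodesic from \<open>c\<close> to
    \<open>v\<close>, \<open>d c z\<close> is the difference of their distances from
    \<open>v\<close>. It is at most \<open>k\<close> because the bag also contains \<open>q\<close>,
    which is no closer to \<open>v\<close> than \<open>a\<close> is.\<close>
  have near: "d c z \<le> k" if c: "c \<in> V" "d v c = d v a" and z: "z \<in> B t" "z \<in> I c" for c z
  proof -
    have zV: "z \<in> V" "d c z + d z v = d c v" using z by (auto simp: I_def)
    have "d v q \<le> d v z + d z q" using dist_triangle v zV V by blast
    moreover have "d z q \<le> k" using B t z q by blast
    moreover have "d v a \<le> d v q" using q QU U by auto
    moreover have "d c v = d v c" "d z v = d v z" using dist_sym c v zV by auto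
    ultimately show ?thesis using zV c by linarith
  qed
  \<comment> \<open>Each leg of the route \<open>a\<close>, \<open>x\<close>, \<open>y\<close>,
    \<open>b\<close> costs at most \<open>k\<close>; the middle one joins two points of the same
    bag.\<close>
  have "d a b \<le> d a x + d x b" "d x b \<le> d x y + d y b"
    using dist_triangle a b V by auto
  moreover have "d a x \<le> k" "d x y \<le> k" "d b y \<le> k"
    using near[of a x] near[of b y] a b lev x y B t by auto
  moreover have "d y b = d b y" using dist_sym b V by auto
  ultimately show ?thesis by linarith
qed

end

section \<open>Adaptive querying\<close>

text \<open>
  The graphs of \<open>\<H>\<close> are those compatible with the answers so far: at most \<open>m\<close> further
  adaptive queries ensure that the graphs that remain compatible satisfy \<open>\<Phi>\<close> collectively.
\<close>
inductive learnable :: "'q set \<Rightarrow> ('g \<Rightarrow> 'q \<Rightarrow> nat) \<Rightarrow> ('g set \<Rightarrow> bool) \<Rightarrow> nat \<Rightarrow> 'g set \<Rightarrow> bool"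
  for Q ans \<Phi> where
  known: "\<Phi> \<H> \<Longrightarrow> learnable Q ans \<Phi> m \<H>"
| ask: "q \<in> Q \<Longrightarrow> (\<And>a. learnable Q ans \<Phi> m {g \<in> \<H>. ans g q = a}) \<Longrightarrow>
    learnable Q ans \<Phi> (Suc m) \<H>"

lemma learnable_mono:
  "learnable Q ans \<Phi> m \<H> \<Longrightarrow> m \<le> m' \<Longrightarrow> learnable Q ans \<Phi> m' \<H>"
proof (induction arbitrary: m' rule: learnable.induct)
  case (ask q m \<H>)
  then obtain m'' where "m' = Suc m''" "m \<le> m''" by (cases m') auto
  with ask show ?case by (auto intro: learnable.ask)
qed (rule learnable.known)

text \<open>Sequential composition: answers only discard graphs, so the continuation is required on
  subclasses alone.\<close>

lemma learnable_bind:
  assumes "learnable Q ans \<Phi> m \<H>"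
    and "\<And>\<H>'. \<H>' \<subseteq> \<H> \<Longrightarrow> \<Phi> \<H>' \<Longrightarrow> learnable Q ans \<Psi> m' \<H>'"
  shows "learnable Q ans \<Psi> (m + m') \<H>"
  using assms
proof induction
  case (known \<H> m)
  then show ?case by (meson learnable_mono le_add2 order_refl)
next
  case (ask q m \<H>)
  have "learnable Q ans \<Psi> (m + m') {g \<in> \<H>. ans g q = a}" for a
    by (rule ask.IH) (rule ask.prems, auto)
  with ask.hyps(1) show ?case by (auto intro: learnable.ask)
qed

text \<open>The answers to a fixed set of queries need no names: it suffices to continue from every
  subclass on which each query of the set has a constant answer.\<close>

lemma learnable_batch:
  assumes "finite S" "S \<subseteq> Q"
    and "\<And>\<H>'. \<H>' \<subseteq> \<H> \<Longrightarrow> (\<And>q g g'. q \<in> S \<Longrightarrow> g \<in> \<H>' \<Longrightarrow> g' \<in> \<H>' \<Longrightarrow> ans g q = ans g' q) \<Longrightarrow>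
      learnable Q ans \<Phi> m \<H>'"
  shows "learnable Q ans \<Phi> (card S + m) \<H>"
  using assms
proof (induction S arbitrary: \<H> rule: finite_induct)
  case empty
  then show ?case by simp
next
  case (insert q S)
  have "learnable Q ans \<Phi> (card S + m) {g \<in> \<H>. ans g q = a}" for a
  proof (rule insert.IH)
    show "S \<subseteq> Q" using insert.prems by blast
    fix \<H>' assume H: "\<H>' \<subseteq> {g \<in> \<H>. ans g q = a}"
      and c: "\<And>q g g'. q \<in> S \<Longrightarrow> g \<in> \<H>' \<Longrightarrow> g' \<in> \<H>' \<Longrightarrow> ans g q = ans g' q"
    show "learnable Q ans \<Phi> m \<H>'"
    proof (rule insert.prems(2))
      show "\<H>' \<subseteq> \<H>" using H by blast
      show "ans g p = ans g' p" if "p \<in> insert q S" "g \<in> \<H>'" "g' \<in> \<H>'" for p g g'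
      proof (cases "p = q")
        case True
        have "ans g q = a" "ans g' q = a" using that H by auto
        then show ?thesis using True by simp
      qed (use that c in blast)
    qed
  qed
  then have "learnable Q ans \<Phi> (Suc (card S + m)) \<H>"
    using insert.prems by (intro learnable.ask[of q]) auto
  with insert.hyps show ?case by simp
qed

text \<open>A derivation of \<open>learnable\<close> is a decision tree and becomes an algorithm
  without \<open>Randomise\<close>, so its transcript is a point mass. A compatible graph gives the
  same answers and follows the same branch to a leaf, where at most one graph remains.\<close>

lemma learnable_query_alg:
  assumes "learnable (V \<times> V) (distance_oracle V) (\<lambda>\<H>. \<forall>E\<in>\<H>. \<forall>E'\<in>\<H>. E = E') m \<H>"
  shows "\<exists>A. query_set A \<subseteq> V \<times> V \<and> (\<forall>E\<in>\<H>. \<exists>\<tau>.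
    transcript (distance_oracle V E) A = return_pmf \<tau> \<and> length \<tau> \<le> m \<and>
    (\<forall>E'\<in>\<H>. compatible V \<tau> E' \<longrightarrow> E' = E))"
  using assms
proof induction
  case (known \<H> m)
  then show ?case by (intro exI[of _ Stop]) auto
next
  case (ask q m \<H>)
  then obtain f where f: "\<And>a. query_set (f a) \<subseteq> V \<times> V"
    and g: "\<And>a E. E \<in> \<H> \<Longrightarrow> distance_oracle V E q = a \<Longrightarrow>
      \<exists>\<tau>. transcript (distance_oracle V E) (f a) = return_pmf \<tau> \<and> length \<tau> \<le> m \<and>
        (\<forall>E'\<in>\<H>. distance_oracle V E' q = a \<longrightarrow> compatible V \<tau> E' \<longrightarrow> E' = E)"
    by simp metis
  show ?case
  proof (intro exI[of _ "Query q f"] conjI ballI)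
    show "query_set (Query q f) \<subseteq> V \<times> V" using ask.hyps(1) f by auto
    fix E assume E: "E \<in> \<H>"
    from g[OF E refl] obtain \<tau> where
      "transcript (distance_oracle V E) (f (distance_oracle V E q)) = return_pmf \<tau>"
      "length \<tau> \<le> m" "\<forall>E'\<in>\<H>. distance_oracle V E' q = distance_oracle V E q \<longrightarrow>
        compatible V \<tau> E' \<longrightarrow> E' = E" by blast
    then show "\<exists>\<tau>. transcript (distance_oracle V E) (Query q f) = return_pmf \<tau> \<and>
      length \<tau> \<le> Suc m \<and> (\<forall>E'\<in>\<H>. compatible V \<tau> E' \<longrightarrow> E' = E)"
      by (intro exI[of _ "(q, distance_oracle V E q) # \<tau>"]) (auto simp: compatible_def)
  qed
qed

section \<open>Reconstruction by levels\<close>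

text \<open>One implication suffices: \<open>E\<close> and \<open>E'\<close> range over the same
  class, so exchanging them gives the converse.\<close>

definition agree_on :: "'v set set set \<Rightarrow> 'v set \<Rightarrow> bool" where
  "agree_on \<H> W \<longleftrightarrow> (\<forall>E\<in>\<H>. \<forall>E'\<in>\<H>. \<forall>x\<in>W. \<forall>y\<in>W. {x, y} \<in> E \<longrightarrow> {x, y} \<in> E')"

lemma agree_onD:
  "agree_on \<H> W \<Longrightarrow> E \<in> \<H> \<Longrightarrow> E' \<in> \<H> \<Longrightarrow> x \<in> W \<Longrightarrow> y \<in> W \<Longrightarrow> {x, y} \<in> E \<Longrightarrow> {x, y} \<in> E'"
  unfolding agree_on_def by blast

lemma agree_on_subset: "agree_on \<H> W \<Longrightarrow> \<H>' \<subseteq> \<H> \<Longrightarrow> W' \<subseteq> W \<Longrightarrow> agree_on \<H>' W'"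
  unfolding agree_on_def by blast

text \<open>\<open>lev\<close> stands for the answers to the initial queries from \<open>v0\<close>,
  which all graphs still compatible share; hence it is fixed apart from any graph.\<close>

locale levelled =
  fixes \<Delta> k :: nat and V :: "'v set" and v0 :: 'v and lev :: "'v \<Rightarrow> nat"
  assumes fin: "finite V" and v0: "v0 \<in> V"
begin

definition levelled_class :: "'v set set set \<Rightarrow> bool" where
  "levelled_class \<H> \<longleftrightarrow> \<H> \<subseteq> bounded_treelength_graphs \<Delta> k V \<and>
     (\<forall>E\<in>\<H>. \<forall>x\<in>V. graph_dist V E v0 x = lev x)"

abbreviation learn :: "('v set set set \<Rightarrow> bool) \<Rightarrow> nat \<Rightarrow> 'v set set set \<Rightarrow> bool" where
  "learn \<equiv> learnable (V \<times> V) (distance_oracle V)"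

lemma levelled_class_subset: "levelled_class \<H> \<Longrightarrow> \<H>' \<subseteq> \<H> \<Longrightarrow> levelled_class \<H>'"
  unfolding levelled_class_def by blast

lemma levelled_classD:
  assumes "levelled_class \<H>" "E \<in> \<H>"
  shows "cgraph V E" "max_degree V E \<le> \<Delta>" "treelength V E \<le> k"
    "\<And>x. x \<in> V \<Longrightarrow> graph_dist V E v0 x = lev x"
  using assms by (auto simp: levelled_class_def bounded_treelength_graphs_def cgraph_def)

section \<open>Levels and geodesics from the root\<close>

lemma lev_edge:
  assumes "levelled_class \<H>" "E \<in> \<H>" "{x, y} \<in> E"
  shows "x \<in> V" "y \<in> V" "x \<noteq> y" "lev y \<le> Suc (lev x)" "lev x \<le> Suc (lev y)"
proof -
  interpret cgraph V E using levelled_classD assms by blast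
  show xy: "x \<in> V" "y \<in> V" "x \<noteq> y" using edgeD assms by auto
  have "d x y = 1" "d y x = 1" using dist_edge[of x y] dist_edge[of y x] assms
    by (auto simp: insert_commute)
  then show "lev y \<le> Suc (lev x)" "lev x \<le> Suc (lev y)"
    using dist_triangle[of v0 x y] dist_triangle[of v0 y x] v0 xy levelled_classD(4)[OF assms(1,2)]
    by auto
qed

lemma parent_exists:
  assumes "levelled_class \<H>" "E \<in> \<H>" "b \<in> V" "lev b = Suc i"
  obtains y where "y \<in> V" "lev y = i" "{y, b} \<in> E"
proof -
  interpret cgraph V E using levelled_classD assms by blast
  have "d b v0 = Suc i" using levelled_classD(4)[OF assms(1,2)] assms dist_sym v0 by auto
  then obtain y where "y \<in> V" "{b, y} \<in> E" "d y v0 = i"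
    using dist_step assms v0 by blast
  then show thesis
    using that levelled_classD(4)[OF assms(1,2)] dist_sym[of y v0] v0 by (auto simp: insert_commute)
qed

text \<open>As levels are known, the single query \<open>(x, u)\<close> decides whether
  \<open>x\<close> is on a shortest path from \<open>v0\<close> to \<open>u\<close>.\<close>

definition on_geodesic :: "'v \<Rightarrow> 'v set set \<Rightarrow> 'v \<Rightarrow> bool" where
  "on_geodesic u E x \<longleftrightarrow> lev x + graph_dist V E x u = lev u"

text \<open>A neighbour of \<open>x\<close> nearer to \<open>u\<close> must gain a level, since
  otherwise \<open>v0\<close> would reach \<open>u\<close> in fewer than \<open>lev u\<close>
  steps.\<close>

lemma geodesic_step:
  assumes "levelled_class \<H>" "E \<in> \<H>" "x \<in> V" "u \<in> V" "on_geodesic u E x" "lev x < lev u"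
  obtains y where "y \<in> V" "{x, y} \<in> E" "lev y = Suc (lev x)" "on_geodesic u E y"
proof -
  interpret cgraph V E using levelled_classD assms by blast
  obtain l where l: "d x u = Suc l"
    using assms by (cases "d x u") (auto simp: on_geodesic_def)
  then obtain y where y: "y \<in> V" "{x, y} \<in> E" "d y u = l"
    using dist_step assms by blast
  have "lev u \<le> lev y + d y u"
    using dist_triangle[of v0 y u] v0 y assms levelled_classD(4)[OF assms(1,2)] by auto
  moreover have "lev y \<le> Suc (lev x)" using lev_edge assms y by blast
  ultimately have "lev y = Suc (lev x)" "on_geodesic u E y"
    using assms(5) l y by (auto simp: on_geodesic_def)
  with y that show thesis by blast
qed

lemma geodesic_parent:
  assumes "levelled_class \<H>" "E \<in> \<H>" "x \<in> V" "u \<in> V" "on_geodesic u E x" "lev u = Suc (lev x)"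
  shows "{x, u} \<in> E"
proof -
  interpret cgraph V E using levelled_classD assms by blast
  have "d x u = 1" using assms by (simp add: on_geodesic_def)
  then show ?thesis using dist_1 assms by blast
qed

text \<open>Follow a shortest path from \<open>x\<close> towards \<open>u\<close>: each step gains
  one level and, up to level \<open>i\<close>, stays in \<open>D\<close> by closedness.\<close>

lemma geodesic_reaches:
  assumes H: "levelled_class \<H>" "E \<in> \<H>" and u: "u \<in> V" "lev u = Suc i" and D: "D \<subseteq> {x \<in> V. lev x \<le> i}"
    and closed: "\<And>x y. x \<in> D \<Longrightarrow> y \<in> V \<Longrightarrow> on_geodesic u E x \<Longrightarrow> {x, y} \<in> E \<Longrightarrow>
      lev y = Suc (lev x) \<Longrightarrow> lev y \<le> i \<Longrightarrow> on_geodesic u E y \<Longrightarrow> y \<in> D"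
    and x: "x \<in> D" "on_geodesic u E x"
  shows "\<exists>y\<in>D. lev y = i"
  using x
proof (induction "i - lev x" arbitrary: x)
  case 0
  then show ?case using D by (intro bexI[of _ x]) auto
next
  case (Suc n)
  have "x \<in> V" "lev x < lev u" using Suc D u by auto
  then obtain y where y: "y \<in> V" "{x, y} \<in> E" "lev y = Suc (lev x)" "on_geodesic u E y"
    using geodesic_step[OF H _ u(1) Suc.prems(2)] by blast
  then have "y \<in> D" using closed[of x y] Suc by auto
  then show ?case using Suc.hyps(1)[of y] Suc.hyps(2) y by auto
qed

section \<open>Binary search for a parent\<close>

definition sep_cost :: nat where "sep_cost = Suc \<Delta> ^ k * Suc \<Delta>"

text \<open>
  Binary search for a parent of \<open>u\<close>. The root \<open>r\<close> is known to lie on a shortest path from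
  \<open>v0\<close> to \<open>u\<close>, and the part below \<open>r\<close> of every such path is trapped in \<open>D\<close>. Querying a
  separator \<open>S\<close> and its neighbours yields a new root strictly below all vertices of \<open>S\<close> on these
  paths, so the search continues in one connected set avoiding \<open>S\<close>, which contains at most
  half of the candidate parents.
\<close>
lemma find_parent_search:
  assumes "levelled_class \<H>" "u \<in> V" "lev u = Suc i" "agree_on \<H> {x \<in> V. lev x \<le> i}"
    and "D \<subseteq> {x \<in> V. lev x \<le> i}" "r \<in> D" "\<And>E. E \<in> \<H> \<Longrightarrow> on_geodesic u E r"
    and "\<And>E x y. E \<in> \<H> \<Longrightarrow> x \<in> D \<Longrightarrow> y \<in> V \<Longrightarrow> on_geodesic u E x \<Longrightarrow> {x, y} \<in> E \<Longrightarrow>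
      lev y = Suc (lev x) \<Longrightarrow> lev y \<le> i \<Longrightarrow> on_geodesic u E y \<Longrightarrow> y \<in> D"
    and "card {x \<in> D. lev x = i} < 2 ^ m"
  shows "learn (\<lambda>\<H>'. \<exists>x. \<forall>E\<in>\<H>'. x \<in> V \<and> lev x = i \<and> {x, u} \<in> E) (sep_cost * m) \<H>"
  using assms
proof (induction m arbitrary: \<H> D r)
  case 0
  \<comment> \<open>Fewer than \<open>2 ^ 0\<close> candidates means none, but in every graph a
    geodesic reaches level \<open>i\<close> inside \<open>D\<close>. So no graph remains.\<close>
  have "finite D" using 0(5) fin finite_subset by fastforce
  then have "{x \<in> D. lev x = i} = {}" using 0(9) by simp
  moreover have "\<exists>y\<in>D. lev y = i" if "E \<in> \<H>" for E
    by (rule geodesic_reaches[OF 0(1) that 0(2,3,5) 0(8)[OF that] 0(6) 0(7)[OF that]])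
  ultimately have "\<H> = {}" by blast
  then show ?case by (auto intro: learnable.known)
next
  case (Suc m)
  note H = Suc.prems(1) and u = Suc.prems(2,3) and agree = Suc.prems(4) and D = Suc.prems(5)
    and r = Suc.prems(6,7) and closed = Suc.prems(8) and cardD = Suc.prems(9)
  let ?\<Phi> = "\<lambda>\<H>'. \<exists>x. \<forall>E\<in>\<H>'. x \<in> V \<and> lev x = i \<and> {x, u} \<in> E"
  show ?case
  proof (cases "\<H> = {}")
    case True
    then show ?thesis by (auto intro: learnable.known)
  next
    case False
    \<comment> \<open>The separator and its neighbourhoods are taken in one representative
      \<open>E0\<close>. Inside \<open>D\<close> all graphs of \<open>\<H>\<close> have the same
      edges.\<close>
    then obtain E0 where E0: "E0 \<in> \<H>" by blast
    interpret cgraph V E0 using levelled_classD H E0 by blast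
    define Y where "Y = {x \<in> D. lev x = i}"
    have finD: "finite D" using D fin finite_subset by fastforce
    obtain S where S: "S \<subseteq> V" "card S \<le> Suc \<Delta> ^ k"
      and sep: "\<And>K. K \<subseteq> V \<Longrightarrow> conn_in E0 K \<Longrightarrow> K \<inter> S = {} \<Longrightarrow> 2 * card (K \<inter> Y) \<le> card Y"
      using balanced_separator[OF levelled_classD(2,3)[OF H E0], of Y] finD
      by (auto simp: Y_def)
    have finS: "finite S" using S fin finite_subset by blast
    \<comment> \<open>Neighbours are queried as well because the new root may be the vertex
      following the last separator vertex on a geodesic.\<close>
    define P where "P = (\<Union>s\<in>S. insert s {y \<in> V. {s, y} \<in> E0})"
    have PV: "P \<subseteq> V" using S by (auto simp: P_def)
    have "card P \<le> (\<Sum>s\<in>S. card (insert s {y \<in> V. {s, y} \<in> E0}))"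
      unfolding P_def by (rule card_UN_le[OF finS])
    also have "\<dots> \<le> (\<Sum>s\<in>S. Suc \<Delta>)"
      by (rule sum_mono)
        (use card_neighbours S levelled_classD(2)[OF H E0] fin in \<open>auto simp: card_insert_if le_SucI\<close>)
    also have "\<dots> \<le> sep_cost" using S by (simp add: sep_cost_def del: mult_Suc_right mult_Suc)
    finally have cardP: "card P \<le> sep_cost" .
    have "learn ?\<Phi> (card (P \<times> {u}) + sep_cost * m) \<H>"
    proof (rule learnable_batch)
      show "finite (P \<times> {u})" using PV fin finite_subset by blast
      show "P \<times> {u} \<subseteq> V \<times> V" using PV u by blast
      fix \<H>' assume H': "\<H>' \<subseteq> \<H>"
        and const: "\<And>q E E'. q \<in> P \<times> {u} \<Longrightarrow> E \<in> \<H>' \<Longrightarrow> E' \<in> \<H>' \<Longrightarrow>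
          distance_oracle V E q = distance_oracle V E' q"
      have geo: "on_geodesic u E' x" if "x \<in> P" "E \<in> \<H>'" "E' \<in> \<H>'" "on_geodesic u E x" for x E E'
        using const[of "(x, u)" E E'] that by (simp add: on_geodesic_def distance_oracle_def)
      have edge0: "{x, y} \<in> E0" if "x \<in> D" "y \<in> D" "E \<in> \<H>'" "{x, y} \<in> E" for x y E
        using agree_onD[OF agree _ E0, of E x y] that D H' by blast
      have SP: "S \<subseteq> P" by (auto simp: P_def)
      show "learn ?\<Phi> (sep_cost * m) \<H>'"
      proof (cases "?\<Phi> \<H>'")
        case True
        then show ?thesis by (rule learnable.known)
      next
        case False
        then obtain E1 where E1: "E1 \<in> \<H>'" by blast
        \<comment> \<open>If no vertex of \<open>S \<inter> D\<close> is on a geodesic, the old root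
          still works. Otherwise take such a vertex \<open>s\<close> of greatest level; the next
          geodesic vertex \<open>z\<close> was queried as a neighbour of \<open>s\<close>, and it is
          outside \<open>S\<close> by maximality.\<close>
        have "\<exists>r'\<in>D - S. (\<forall>E\<in>\<H>'. on_geodesic u E r') \<and>
          (\<forall>x\<in>S \<inter> D. on_geodesic u E1 x \<longrightarrow> lev x < lev r')"
        proof (cases "\<exists>s\<in>S \<inter> D. on_geodesic u E1 s")
          case False
          then show ?thesis using r H' E1 by (intro bexI[of _ r]) auto
        next
          case True
          let ?G = "{s \<in> S \<inter> D. on_geodesic u E1 s}"
          have G: "finite (lev ` ?G)" "lev ` ?G \<noteq> {}" using finD True by auto
          obtain s where s: "s \<in> ?G" and eq: "Max (lev ` ?G) = lev s"
            by (rule imageE[OF Max_in[OF G]]) (rule that)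
          have mx: "lev x \<le> lev s" if "x \<in> ?G" for x
            unfolding eq[symmetric] by (rule Max_ge[OF G(1) imageI[OF that]])
          have sV: "s \<in> V" "lev s \<le> i" using s D by auto
          \<comment> \<open>In level \<open>i\<close> the vertex \<open>s\<close> would be a parent
            of \<open>u\<close> in all remaining graphs, the case already settled.\<close>
          have "lev s \<noteq> i"
          proof
            assume "lev s = i"
            moreover have "{s, u} \<in> E" if "E \<in> \<H>'" for E
            proof (rule geodesic_parent)
              show "on_geodesic u E s" using geo[of s E1 E] s SP E1 that by blast
            qed (use levelled_class_subset[OF H H'] that sV u \<open>lev s = i\<close> in auto)
            ultimately show False using \<open>\<not> ?\<Phi> \<H>'\<close> sV by blast
          qed
          then obtain z where z: "z \<in> V" "{s, z} \<in> E1" "lev z = Suc (lev s)" "on_geodesic u E1 z"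
            using geodesic_step[OF H _ sV(1) u(1)] H' E1 s sV u by auto
          have zD: "z \<in> D"
            using closed[of E1 s z] H' E1 s z sV \<open>lev s \<noteq> i\<close> by auto
          have "z \<notin> S" using mx[of z] z zD by auto
          moreover have "z \<in> P" using edge0[OF _ zD E1 z(2)] s z by (auto simp: P_def)
          ultimately show ?thesis
            using zD geo[of z E1] E1 z mx by (intro bexI[of _ z]) (auto simp: less_Suc_eq_le)
        qed
        then obtain r' where r': "r' \<in> D - S" "\<And>E. E \<in> \<H>' \<Longrightarrow> on_geodesic u E r'"
          and below: "\<And>x. x \<in> S \<inter> D \<Longrightarrow> on_geodesic u E1 x \<Longrightarrow> lev x < lev r'" by blast
        \<comment> \<open>Geodesics beyond \<open>r'\<close> gain one level per edge, so only such
          edges are followed. The set reached is connected and avoids \<open>S\<close>, which is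
          what halves the candidates.\<close>
        define R where "R = {(x, y) \<in> adj E0 (D - S). lev y = Suc (lev x)}"
        define D' where "D' = {x. (r', x) \<in> R\<^sup>*}"
        have D'_sub: "D' \<subseteq> D - S"
        proof
          fix x assume "x \<in> D'"
          then have "(r', x) \<in> R\<^sup>*" by (simp add: D'_def)
          then show "x \<in> D - S" using r'(1) by cases (auto simp: R_def adj_def)
        qed
        have D'_lev: "lev r' \<le> lev x" if "x \<in> D'" for x
        proof -
          from that have "(r', x) \<in> R\<^sup>*" by (simp add: D'_def)
          then show ?thesis by induction (auto simp: R_def)
        qed
        have D'_conn: "conn_in E0 D'"
        proof (rule conn_in_star)
          show "r' \<in> D'" by (simp add: D'_def)
          fix x assume "x \<in> D'"
          then have "(r', x) \<in> R\<^sup>*" by (simp add: D'_def)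
          then show "(r', x) \<in> (adj E0 D')\<^sup>*"
          proof induction
            case (step y z)
            have "y \<in> D'" "z \<in> D'"
              using step.hyps by (auto simp: D'_def intro: rtrancl_into_rtrancl)
            then have "(y, z) \<in> adj E0 D'" using step.hyps(2) by (auto simp: R_def adj_def)
            with step.IH show ?case by (rule rtrancl_into_rtrancl)
          qed simp
        qed
        show ?thesis
        proof (rule Suc.IH)
          show "levelled_class \<H>'" using levelled_class_subset H H' by blast
          show "agree_on \<H>' {x \<in> V. lev x \<le> i}" using agree_on_subset[OF agree H'] by blast
          show "D' \<subseteq> {x \<in> V. lev x \<le> i}" using D'_sub D by blast
          show "r' \<in> D'" by (simp add: D'_def)
          show "on_geodesic u E r'" if "E \<in> \<H>'" for E using r' that by blast
          have "{x \<in> D'. lev x = i} = D' \<inter> Y" using D'_sub by (auto simp: Y_def)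
          moreover have "2 * card (D' \<inter> Y) \<le> card Y"
            by (rule sep) (use D'_sub D D'_conn in auto)
          ultimately show "card {x \<in> D'. lev x = i} < 2 ^ m"
            using cardD by (simp add: Y_def)
          fix E x y
          assume E: "E \<in> \<H>'" and x: "x \<in> D'" "on_geodesic u E x" and y: "y \<in> V" "{x, y} \<in> E"
            "lev y = Suc (lev x)" "lev y \<le> i" "on_geodesic u E y"
          have yD: "y \<in> D" using closed[of E x y] E H' x y D'_sub by blast
          \<comment> \<open>Geodesic vertices in \<open>S \<inter> D\<close> have levels below that
            of \<open>r'\<close>, whereas levels in \<open>D'\<close> are at least that of
            \<open>r'\<close>. So no geodesic leaves \<open>D'\<close> through
            \<open>S\<close>.\<close>
          have "y \<notin> S"
          proof
            assume "y \<in> S"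
            then have "lev y < lev r'" using below[of y] geo[of y E E1] yD SP E E1 y by blast
            then show False using D'_lev[OF x(1)] y by simp
          qed
          then have "(x, y) \<in> R"
            using x y D'_sub yD edge0[OF _ yD E y(2)] by (auto simp: R_def adj_def)
          then show "y \<in> D'" using x by (auto simp: D'_def intro: rtrancl_into_rtrancl)
        qed (use u in auto)
      qed
    qed
    then show ?thesis
      by (rule learnable_mono) (use cardP in \<open>simp add: card_cartesian_product\<close>)
  qed
qed

section \<open>Components above a level\<close>

definition same_component :: "'v set set \<Rightarrow> 'v \<Rightarrow> 'v \<Rightarrow> bool" where
  "same_component E a b \<longleftrightarrow> lev b = lev a \<and> (a, b) \<in> (adj E {x \<in> V. lev a \<le> lev x})\<^sup>*"

lemma same_component_sym: "same_component E a b \<Longrightarrow> same_component E b a"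
  by (simp add: same_component_def adj_rtrancl_sym)

lemma same_component_dist:
  assumes "levelled_class \<H>" "E \<in> \<H>" "a \<in> V" "same_component E a b"
  shows "graph_dist V E a b \<le> 3 * k"
proof -
  interpret cgraph V E using levelled_classD assms by blast
  have lev: "d v0 x = lev x" if "x \<in> V" for x using levelled_classD(4)[OF assms(1,2) that] .
  have "b \<in> V" using assms(3,4) unfolding same_component_def
    by (auto elim: rtranclE simp: adj_def)
  then show ?thesis
    using levelled_classD(3)[OF assms(1,2)] v0 assms(3,4) lev
    by (intro upper_component_dist[where v = v0 and U = "{x \<in> V. lev a \<le> lev x}"])
      (auto simp: same_component_def)
qed

text \<open>The walk from \<open>b\<close> to \<open>u\<close> is extended by one step down at both
  ends and stays above the level of \<open>y\<close>. This is how vertices joined to a new vertex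
  \<open>u\<close> are found: through their parents, which lie in a level already inserted.\<close>

lemma same_component_parents:
  assumes H: "levelled_class \<H>" "E \<in> \<H>" and uv: "same_component E u b"
    and x: "{x, u} \<in> E" "lev u = Suc (lev x)" and y: "{y, b} \<in> E" "lev b = Suc (lev y)"
  shows "same_component E y x"
proof -
  let ?U = "{z \<in> V. lev y \<le> lev z}"
  have lev: "lev y = lev x" "lev b = lev u" using uv x y by (auto simp: same_component_def)
  have "(y, b) \<in> adj E ?U" "(u, x) \<in> adj E ?U"
    using lev_edge[OF H x(1)] lev_edge[OF H y(1)] x y lev by (auto simp: adj_def insert_commute)
  moreover have "(b, u) \<in> (adj E ?U)\<^sup>*"
  proof -
    have "(b, u) \<in> (adj E {x \<in> V. lev b \<le> lev x})\<^sup>*"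
      using same_component_sym[OF uv] by (simp add: same_component_def)
    moreover have "adj E {x \<in> V. lev b \<le> lev x} \<subseteq> adj E ?U"
      by (rule adj_mono) (use y in auto)
    ultimately show ?thesis using rtrancl_mono by blast
  qed
  ultimately have "(y, x) \<in> (adj E ?U)\<^sup>*"
    by (meson converse_rtrancl_into_rtrancl rtrancl_into_rtrancl)
  then show ?thesis using lev by (simp add: same_component_def)
qed

text \<open>
  Which vertices of a level are joined above that level need not be determined by the answers; \<open>M\<close>
  is an overapproximation of this relation that is the same for all graphs in \<open>\<H>\<close> and still
  consists of close pairs only.
\<close>
definition insertion_state ::
  "'v set \<Rightarrow> ('v \<times> 'v) set \<Rightarrow> 'v set set set \<Rightarrow> bool" where
  "insertion_state W M \<H> \<longleftrightarrow> levelled_class \<H> \<and> v0 \<in> W \<and> W \<subseteq> V \<and>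
     (\<forall>x\<in>W. \<forall>y\<in>V. lev y < lev x \<longrightarrow> y \<in> W) \<and> agree_on \<H> W \<and>
     (\<forall>E\<in>\<H>. \<forall>(a, b)\<in>M. graph_dist V E a b \<le> 3 * k) \<and>
     (\<forall>E\<in>\<H>. \<forall>a\<in>W. \<forall>b\<in>W. same_component E a b \<longrightarrow> (a, b) \<in> M)"

section \<open>Insertion of a single vertex\<close>

definition insert_cost :: nat where "insert_cost = Suc \<Delta> ^ (3 * k + 1)"

lemma find_parent:
  assumes H: "levelled_class \<H>" and u: "u \<in> V" "lev u = Suc i"
    and agree: "agree_on \<H> {x \<in> V. lev x \<le> i}" and m: "card V < 2 ^ m"
  shows "learn (\<lambda>\<H>'. \<exists>x. \<forall>E\<in>\<H>'. x \<in> V \<and> lev x = i \<and> {x, u} \<in> E) (sep_cost * m) \<H>"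
proof (cases "\<H> = {}")
  case True
  then show ?thesis by (auto intro: learnable.known)
next
  case False
  then obtain E0 where E0: "E0 \<in> \<H>" by blast
  interpret cgraph V E0 using levelled_classD H E0 by blast
  have l0: "lev v0 = 0" using levelled_classD(4)[OF H E0 v0] v0 by simp
  show ?thesis
  proof (rule find_parent_search[OF H u agree, where r = v0 and D = "{x \<in> V. lev x \<le> i}"])
    show "on_geodesic u E v0" if "E \<in> \<H>" for E
      using levelled_classD(4)[OF H that u(1)] l0 by (simp add: on_geodesic_def)
    show "card {x \<in> {x \<in> V. lev x \<le> i}. lev x = i} < 2 ^ m"
      by (rule le_less_trans[OF card_mono m]) (use fin in auto)
  qed (use v0 l0 in auto)
qed

text \<open>Once a parent \<open>p\<close> is known, the vertices of \<open>W\<close> adjacent to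
  \<open>u\<close>, or joined to it above its level, lie in a set \<open>Cand\<close> of bounded
  size around \<open>p\<close>. The distances from \<open>u\<close> to \<open>Cand\<close> settle
  the new edges and bound the new pairs of \<open>M\<close> in all graphs at once.\<close>

lemma insert_vertex:
  assumes st: "insertion_state W M \<H>" and u: "u \<in> V - W"
    and min: "\<And>y. y \<in> V \<Longrightarrow> lev y < lev u \<Longrightarrow> y \<in> W" and m: "card V < 2 ^ m"
  shows "learn (\<lambda>\<H>'. \<exists>M'. insertion_state (insert u W) M' \<H>') (sep_cost * m + insert_cost) \<H>"
proof (cases "\<H> = {}")
  case True
  with st u have "insertion_state (insert u W) M \<H>"
    using min by (auto simp: insertion_state_def agree_on_def)
  then show ?thesis by (auto intro: learnable.known)
next
  case False
  then obtain E0 where E0: "E0 \<in> \<H>" by blast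
  have H: "levelled_class \<H>" and W: "W \<subseteq> V" and v0W: "v0 \<in> W"
    and down: "\<And>x y. x \<in> W \<Longrightarrow> y \<in> V \<Longrightarrow> lev y < lev x \<Longrightarrow> y \<in> W"
    and agree: "agree_on \<H> W"
    and Md: "\<And>E a b. E \<in> \<H> \<Longrightarrow> (a, b) \<in> M \<Longrightarrow> graph_dist V E a b \<le> 3 * k"
    and Mc: "\<And>E a b. E \<in> \<H> \<Longrightarrow> a \<in> W \<Longrightarrow> b \<in> W \<Longrightarrow> same_component E a b \<Longrightarrow> (a, b) \<in> M"
    using st unfolding insertion_state_def by blast+
  have uV: "u \<in> V" "u \<notin> W" using u by auto
  have W_lev: "lev x \<le> lev u" if "x \<in> W" for x
    using down[OF that uV(1)] uV(2) by (meson not_less)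
  have "lev u \<noteq> 0"
  proof
    assume "lev u = 0"
    interpret cgraph V E0 using levelled_classD H E0 by blast
    have "v0 = u" using levelled_classD(4)[OF H E0 uV(1)] \<open>lev u = 0\<close> dist_0 v0 uV by auto
    then show False using v0W uV by simp
  qed
  then obtain i where i: "lev u = Suc i" by (cases "lev u") auto
  have agree_i: "agree_on \<H> {x \<in> V. lev x \<le> i}"
    by (rule agree_on_subset[OF agree]) (use min i in auto)
  show ?thesis
  proof (rule learnable_bind[OF find_parent[OF H uV(1) i agree_i m]])
    fix \<H>1 assume H1: "\<H>1 \<subseteq> \<H>" and "\<exists>x. \<forall>E\<in>\<H>1. x \<in> V \<and> lev x = i \<and> {x, u} \<in> E"
    then obtain p where p: "\<And>E. E \<in> \<H>1 \<Longrightarrow> p \<in> V \<and> lev p = i \<and> {p, u} \<in> E" by blast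
    \<comment> \<open>Candidates in level \<open>i\<close> are \<open>M\<close>-related to
      \<open>p\<close>; those in level \<open>Suc i\<close> have a parent that is. The edges are
      read off in \<open>E0\<close>, but within \<open>W\<close> all graphs agree.\<close>
    define Cand where "Cand = {b \<in> W. lev b = i \<and> (b, p) \<in> M} \<union>
      {b \<in> W. lev b = Suc i \<and> (\<exists>y\<in>W. {y, b} \<in> E0 \<and> lev y = i \<and> (y, p) \<in> M)}"
    show "learn (\<lambda>\<H>'. \<exists>M'. insertion_state (insert u W) M' \<H>') insert_cost \<H>1"
    proof (cases "\<H>1 = {}")
      case True
      then have "insertion_state (insert u W) M \<H>1"
        using v0W uV W down min by (auto simp: insertion_state_def agree_on_def levelled_class_def)
      then show ?thesis by (auto intro: learnable.known)
    next
      case False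
      then obtain E1 where E1: "E1 \<in> \<H>1" by blast
      have pV: "p \<in> V" "lev p = i" and pE: "\<And>E. E \<in> \<H>1 \<Longrightarrow> {p, u} \<in> E" using p E1 by auto
      have pW: "p \<in> W" using min pV i by auto
      have edge0: "{x, y} \<in> E0" if "E \<in> \<H>1" "{x, y} \<in> E" "x \<in> W" "y \<in> W" for E x y
        using agree_onD[OF agree _ E0] that H1 by blast
      have Cand_component: "b \<in> Cand" if E: "E \<in> \<H>1" and b: "b \<in> W" "same_component E u b" for E b
      proof -
        have EH: "E \<in> \<H>" using E H1 by blast
        have bl: "lev b = Suc i" using b i by (simp add: same_component_def)
        obtain y where y: "y \<in> V" "lev y = i" "{y, b} \<in> E"
          using parent_exists[OF H EH _ bl] b W by blast
        have yW: "y \<in> W" using min y i by auto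
        have "same_component E y p"
          using same_component_parents[OF H EH b(2) pE[OF E] _ y(3)] i pV bl y by simp
        then have "(y, p) \<in> M" using Mc EH yW pW by blast
        with edge0[OF E y(3) yW b(1)] yW b y bl show ?thesis by (auto simp: Cand_def)
      qed
      \<comment> \<open>A neighbour in level \<open>i\<close> is joined to \<open>p\<close> through
        \<open>u\<close>; one in level \<open>Suc i\<close> is joined to \<open>u\<close> by the
        edge itself.\<close>
      have Cand_edge: "b \<in> Cand" if E: "E \<in> \<H>1" and b: "b \<in> W" "{u, b} \<in> E" for E b
      proof -
        have EH: "E \<in> \<H>" using E H1 by blast
        have bV: "b \<in> V" "lev b \<le> Suc i" "i \<le> lev b"
          using lev_edge[OF H EH b(2)] W_lev[OF b(1)] i by auto
        show ?thesis
        proof (cases "lev b = i")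
          case True
          have "(b, u) \<in> adj E {x \<in> V. lev b \<le> lev x}" "(u, p) \<in> adj E {x \<in> V. lev b \<le> lev x}"
            using b(2) pE[OF E] bV uV i True pV by (auto simp: adj_def insert_commute)
          then have "same_component E b p"
            using True pV by (auto simp: same_component_def)
          then show ?thesis using Mc[OF EH b(1) pW] b True by (auto simp: Cand_def)
        next
          case False
          then have "(u, b) \<in> adj E {x \<in> V. lev u \<le> lev x}"
            using b(2) bV uV i by (auto simp: adj_def)
          then have "same_component E u b" using False bV i by (auto simp: same_component_def)
          then show ?thesis using Cand_component E b by blast
        qed
      qed
      have CandW: "Cand \<subseteq> W" by (auto simp: Cand_def)
      have cardC: "card ({u} \<times> Cand) \<le> insert_cost"
      proof -
        interpret cgraph V E0 using levelled_classD H E0 by blast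
        have Mp: "d p x \<le> 3 * k" if "(x, p) \<in> M" "x \<in> W" for x
          using Md[OF E0 that(1)] dist_sym[of p x] pV W that by auto
        \<comment> \<open>A candidate is within \<open>3 * k\<close> of \<open>p\<close> or one edge
          away from a vertex that is; hence the exponent in \<open>insert_cost\<close>.\<close>
        have "d p b \<le> 3 * k + 1" if "b \<in> Cand" for b
        proof -
          have "b \<in> V" using that CandW W by blast
          from that consider "(b, p) \<in> M" "b \<in> W"
            | y where "y \<in> W" "{y, b} \<in> E0" "(y, p) \<in> M" by (auto simp: Cand_def)
          then show ?thesis
          proof cases
            case 1
            then show ?thesis using Mp[of b] by simp
          next
            case 2
            then show ?thesis
              using Mp[of y] dist_triangle[of p y b] dist_edge[of y b] pV W \<open>b \<in> V\<close> by auto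
          qed
        qed
        then have "card Cand \<le> card {y \<in> V. d p y \<le> 3 * k + 1}"
          using CandW W fin by (intro card_mono) auto
        also have "\<dots> \<le> insert_cost"
          unfolding insert_cost_def by (rule card_ball[OF levelled_classD(2)[OF H E0] pV(1)])
        finally show ?thesis by (simp add: card_cartesian_product)
      qed
      have "learn (\<lambda>\<H>'. \<exists>M'. insertion_state (insert u W) M' \<H>') (card ({u} \<times> Cand) + 0) \<H>1"
      proof (rule learnable_batch)
        show "finite ({u} \<times> Cand)" using CandW W fin by (auto intro: finite_subset)
        show "{u} \<times> Cand \<subseteq> V \<times> V" using CandW W uV by blast
        fix \<H>2 assume H2: "\<H>2 \<subseteq> \<H>1"
          and const: "\<And>q E E'. q \<in> {u} \<times> Cand \<Longrightarrow> E \<in> \<H>2 \<Longrightarrow> E' \<in> \<H>2 \<Longrightarrow>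
            distance_oracle V E q = distance_oracle V E' q"
        have eq: "graph_dist V E u b = graph_dist V E' u b"
          if "b \<in> Cand" "E \<in> \<H>2" "E' \<in> \<H>2" for b E E'
          using const[of "(u, b)" E E'] that by (simp add: distance_oracle_def)
        have HH: "levelled_class \<H>2" using levelled_class_subset H H1 H2 by blast
        \<comment> \<open>Pairs that are close in every remaining graph are added. A new pair joined
          in just one graph qualifies, since its queried distance is common to all of them.\<close>
        define M' where "M' = M \<union> {(u, u)} \<union>
          {(a, b). \<forall>E\<in>\<H>2. a \<in> V \<and> b \<in> V \<and> graph_dist V E a b \<le> 3 * k}"
        have edge: "{u, b} \<in> E'" if E: "E \<in> \<H>2" "E' \<in> \<H>2" and b: "b \<in> W" "{u, b} \<in> E" for b E E'
        proof -
          have "b \<in> Cand" using Cand_edge E H2 b by blast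
          then have "graph_dist V E u b = graph_dist V E' u b" using eq E by blast
          moreover have "b \<in> V" using b W by blast
          ultimately show ?thesis
            using cgraph.dist_1[OF levelled_classD(1)[OF HH E(1)]]
              cgraph.dist_1[OF levelled_classD(1)[OF HH E(2)]] b uV by metis
        qed
        have near: "graph_dist V E' u b \<le> 3 * k"
          if E: "E \<in> \<H>2" "E' \<in> \<H>2" and b: "b \<in> W" "same_component E u b" for b E E'
        proof -
          have "b \<in> Cand" using Cand_component E H2 b by blast
          then have "graph_dist V E' u b = graph_dist V E u b" using eq E by blast
          also have "\<dots> \<le> 3 * k" by (rule same_component_dist[OF HH E(1) uV(1) b(2)])
          finally show ?thesis .
        qed
        have near': "graph_dist V E' b u \<le> 3 * k"
          if E: "E \<in> \<H>2" "E' \<in> \<H>2" and b: "b \<in> W" "same_component E b u" for b E E'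
          using near[OF E b(1) same_component_sym[OF b(2)]]
            cgraph.dist_sym[OF levelled_classD(1)[OF HH E(2)], of b u] b W uV by auto
        have "insertion_state (insert u W) M' \<H>2"
          unfolding insertion_state_def
        proof (intro conjI)
          show "levelled_class \<H>2" by (rule HH)
          show "v0 \<in> insert u W" "insert u W \<subseteq> V" using v0W W uV by auto
          show "\<forall>x\<in>insert u W. \<forall>y\<in>V. lev y < lev x \<longrightarrow> y \<in> insert u W"
            using down min by blast
          show "agree_on \<H>2 (insert u W)"
            unfolding agree_on_def
          proof (intro ballI impI)
            fix E E' x y
            assume E: "E \<in> \<H>2" "E' \<in> \<H>2" and xy: "x \<in> insert u W" "y \<in> insert u W" "{x, y} \<in> E"
            have "x \<noteq> y" using lev_edge[OF HH E(1) xy(3)] by blast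
            then consider "x \<in> W" "y \<in> W" | "x = u" "y \<in> W" | "x \<in> W" "y = u" using xy by blast
            then show "{x, y} \<in> E'"
            proof cases
              case 1
              then show ?thesis using agree_onD[OF agree, of E E'] E H1 H2 xy by blast
            next
              case 2
              then show ?thesis using edge[OF E, of y] xy by simp
            next
              case 3
              then show ?thesis using edge[OF E, of x] xy by (simp add: insert_commute)
            qed
          qed
          show "\<forall>E\<in>\<H>2. \<forall>(a, b)\<in>M'. graph_dist V E a b \<le> 3 * k"
          proof (intro ballI, clarify)
            fix E a b assume E: "E \<in> \<H>2" and "(a, b) \<in> M'"
            then consider "(a, b) \<in> M" | "a = u" "b = u" | "graph_dist V E a b \<le> 3 * k"
              by (auto simp: M'_def)
            then show "graph_dist V E a b \<le> 3 * k"
            proof cases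
              case 1
              then show ?thesis using Md E H1 H2 by blast
            next
              case 2
              then show ?thesis
                using cgraph.dist_refl[OF levelled_classD(1)[OF HH E] uV(1)] by simp
            qed
          qed
          show "\<forall>E\<in>\<H>2. \<forall>a\<in>insert u W. \<forall>b\<in>insert u W. same_component E a b \<longrightarrow> (a, b) \<in> M'"
          proof (intro ballI impI)
            fix E a b assume E: "E \<in> \<H>2" and ab: "a \<in> insert u W" "b \<in> insert u W"
              and c: "same_component E a b"
            consider "a \<in> W" "b \<in> W" | "a = u" "b = u" | "a = u" "b \<in> W" | "a \<in> W" "b = u"
              using ab by blast
            then show "(a, b) \<in> M'"
            proof cases
              case 1
              then show ?thesis using Mc[of E a b] c E H1 H2 by (auto simp: M'_def)
            next
              case 2
              then show ?thesis by (simp add: M'_def)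
            next
              case 3
              then show ?thesis using near[OF E, of _ b] c uV W by (auto simp: M'_def)
            next
              case 4
              then show ?thesis using near'[OF E, of _ a] c uV W by (auto simp: M'_def)
            qed
          qed
        qed
        then show "learn (\<lambda>\<H>'. \<exists>M'. insertion_state (insert u W) M' \<H>') 0 \<H>2"
          by (intro learnable.known) blast
      qed
      then show ?thesis by (rule learnable_mono) (use cardC in simp)
    qed
  qed
qed

section \<open>Insertion of all vertices\<close>

abbreviation determined :: "'v set set set \<Rightarrow> bool" where
  "determined \<H> \<equiv> \<forall>E\<in>\<H>. \<forall>E'\<in>\<H>. E = E'"

lemma determined_by_insertion:
  assumes "insertion_state W M \<H>" "card V < 2 ^ m"
  shows "learn determined (card (V - W) * (sep_cost * m + insert_cost)) \<H>"
  using assms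
proof (induction "card (V - W)" arbitrary: W M \<H>)
  case 0
  then have "V \<subseteq> W" using fin by simp
  with 0 have H: "levelled_class \<H>" and agree: "agree_on \<H> V"
    by (auto simp: insertion_state_def intro: agree_on_subset)
  have "E \<subseteq> E'" if "E \<in> \<H>" "E' \<in> \<H>" for E E'
  proof
    fix e assume e: "e \<in> E"
    have sg: "sgraph V E" using levelled_classD(1)[OF H that(1)] by (simp add: cgraph_def)
    then obtain x y where "e = {x, y}" "x \<in> V" "y \<in> V"
      using e by (auto simp: sgraph_def card_2_iff)
    then show "e \<in> E'" using agree_onD[OF agree that] e by blast
  qed
  then have "determined \<H>" by blast
  then show ?case by (rule learnable.known)
next
  case (Suc n)
  have "V - W \<noteq> {}" using Suc.hyps(2) by (metis card.empty nat.distinct(1))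
  \<comment> \<open>A vertex of least level outside \<open>W\<close> is chosen, so that all lower
    levels are already complete.\<close>
  then obtain u where u: "u \<in> V - W" and least: "\<And>y. y \<in> V - W \<Longrightarrow> lev u \<le> lev y"
    using ex_has_least_nat[of "\<lambda>x. x \<in> V - W" _ lev] by blast
  have min: "y \<in> W" if "y \<in> V" "lev y < lev u" for y
    using least[of y] that by force
  let ?c = "sep_cost * m + insert_cost"
  have "learn determined (?c + n * ?c) \<H>"
  proof (rule learnable_bind[OF insert_vertex[OF Suc.prems(1) u min Suc.prems(2)]])
    fix \<H>' assume "\<exists>M'. insertion_state (insert u W) M' \<H>'"
    then obtain M' where st: "insertion_state (insert u W) M' \<H>'" by blast
    have n: "n = card (V - insert u W)"
      using Suc.hyps(2) u fin by (simp add: card_Diff_insert)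
    show "learn determined (n * ?c) \<H>'"
      unfolding n by (rule Suc.hyps(1)[OF n st Suc.prems(2)])
  qed
  then show ?case using Suc.hyps(2)[symmetric] by simp
qed

end

section \<open>Assembly and the query bound\<close>

lemma determined_learnable:
  assumes fin: "finite V" and ne: "V \<noteq> {}" and m: "card V < 2 ^ m"
  shows "learnable (V \<times> V) (distance_oracle V) (\<lambda>\<H>. \<forall>E\<in>\<H>. \<forall>E'\<in>\<H>. E = E')
    (card V + card V * (Suc \<Delta> ^ k * Suc \<Delta> * m + Suc \<Delta> ^ (3 * k + 1)))
    (bounded_treelength_graphs \<Delta> k V)"
proof -
  obtain v0 where v0: "v0 \<in> V" using ne by blast
  let ?c = "Suc \<Delta> ^ k * Suc \<Delta> * m + Suc \<Delta> ^ (3 * k + 1)"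
  have "learnable (V \<times> V) (distance_oracle V) (\<lambda>\<H>. \<forall>E\<in>\<H>. \<forall>E'\<in>\<H>. E = E')
    (card ({v0} \<times> V) + card V * ?c) (bounded_treelength_graphs \<Delta> k V)"
  proof (rule learnable_batch)
    show "finite ({v0} \<times> V)" "{v0} \<times> V \<subseteq> V \<times> V" using fin v0 by auto
    fix \<H> assume H: "\<H> \<subseteq> bounded_treelength_graphs \<Delta> k V"
      and const: "\<And>q E E'. q \<in> {v0} \<times> V \<Longrightarrow> E \<in> \<H> \<Longrightarrow> E' \<in> \<H> \<Longrightarrow>
        distance_oracle V E q = distance_oracle V E' q"
    show "learnable (V \<times> V) (distance_oracle V) (\<lambda>\<H>. \<forall>E\<in>\<H>. \<forall>E'\<in>\<H>. E = E') (card V * ?c) \<H>"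
    proof (cases "\<H> = {}")
      case True
      then show ?thesis by (auto intro: learnable.known)
    next
      case False
      then obtain E1 where E1: "E1 \<in> \<H>" by blast
      \<comment> \<open>The levels may be read off in any remaining graph, as the queries from
        \<open>v0\<close> have the same answers in all of them.\<close>
      interpret levelled \<Delta> k V v0 "graph_dist V E1 v0"
        by unfold_locales (use fin v0 in auto)
      have HH: "levelled_class \<H>"
        unfolding levelled_class_def
      proof (intro conjI ballI H)
        show "graph_dist V E v0 x = graph_dist V E1 v0 x" if "E \<in> \<H>" "x \<in> V" for E x
          using const[of "(v0, x)" E E1] that E1 by (simp add: distance_oracle_def)
      qed
      have d0: "graph_dist V E v0 v0 = 0" if "E \<in> \<H>" for E
        by (rule cgraph.dist_refl[OF levelled_classD(1)[OF HH that] v0])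
      have "{v0, v0} \<notin> E" if "E \<in> \<H>" for E
        using lev_edge(3)[OF HH that] by blast
      then have "agree_on \<H> {v0}" by (simp add: agree_on_def)
      then have "insertion_state {v0} {(v0, v0)} \<H>"
        using HH v0 d0 E1 by (simp add: insertion_state_def)
      from determined_by_insertion[OF this m]
      show ?thesis
        by (rule learnable_mono)
          (use fin in \<open>auto simp: sep_cost_def insert_cost_def intro!: mult_le_mono1 card_mono simp del: power_Suc\<close>)
    qed
  qed
  then show ?thesis by (simp add: card_cartesian_product)
qed

lemma reconstruction_alg:
  assumes fin: "finite V" and ne: "V \<noteq> {}"
  shows "\<exists>A. query_set A \<subseteq> V \<times> V \<and> reconstructs V (bounded_treelength_graphs \<Delta> k V) A \<and>
    query_complexity V (bounded_treelength_graphs \<Delta> k V) A \<le>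
      ennreal (9 / 4 * (1 + 2 * real (Suc \<Delta> ^ k * Suc \<Delta>) + real (Suc \<Delta> ^ (3 * k + 1)))
        * real (card V) * (ln (real (card V)))\<^sup>2)"
proof (cases "card V = 1")
  \<comment> \<open>For one vertex the bound is 0 because \<open>ln 1 = 0\<close>, so no query may
    be made; only the empty edge set is possible.\<close>
  case True
  then obtain v where v: "V = {v}" by (rule card_1_singletonE)
  have "E = {}" if "sgraph V E" for E
  proof (rule ccontr)
    assume "E \<noteq> {}"
    then obtain e where "e \<in> E" by blast
    then have "e \<subseteq> {v}" "card e = 2" using that v by (auto simp: sgraph_def)
    then show False using card_mono[of "{v}" e] by simp
  qed
  then have "reconstructs V (bounded_treelength_graphs \<Delta> k V) Stop"
    by (auto simp: reconstructs_def bounded_treelength_graphs_def)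
  moreover have "query_complexity V (bounded_treelength_graphs \<Delta> k V) Stop \<le> 0"
    unfolding query_complexity_def by (intro SUP_least) simp
  ultimately show ?thesis by (intro exI[of _ Stop]) auto
next
  case False
  let ?n = "real (card V)" and ?s = "real (Suc \<Delta> ^ k * Suc \<Delta>)" and ?t = "real (Suc \<Delta> ^ (3 * k + 1))"
  let ?\<G> = "bounded_treelength_graphs \<Delta> k V"
  have n: "card V \<ge> 2" using fin ne False card_0_eq[of V] by linarith
  \<comment> \<open>\<open>p\<close> is the binary logarithm of \<open>card V\<close> rounded down,
    so the search is run with \<open>p + 1\<close> halvings.\<close>
  obtain p where p: "2 ^ p \<le> card V" "card V < 2 ^ (p + 1)"
    using ex_power_ivl1[of 2 "card V"] n by auto
  let ?T = "card V + card V * (Suc \<Delta> ^ k * Suc \<Delta> * (p + 1) + Suc \<Delta> ^ (3 * k + 1))"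
  from learnable_query_alg[OF determined_learnable[OF fin ne p(2)]]
  obtain A where A0: "query_set A \<subseteq> V \<times> V \<and> (\<forall>E\<in>?\<G>. \<exists>\<tau>.
    transcript (distance_oracle V E) A = return_pmf \<tau> \<and> length \<tau> \<le> ?T \<and>
    (\<forall>E'\<in>?\<G>. compatible V \<tau> E' \<longrightarrow> E' = E))" ..
  note A = conjunct1[OF A0] conjunct2[OF A0]
  have rec: "reconstructs V ?\<G> A"
    unfolding reconstructs_def
  proof (intro ballI impI)
    fix E \<tau> E' assume E: "E \<in> ?\<G>" "E' \<in> ?\<G>" "compatible V \<tau> E'"
      and \<tau>: "\<tau> \<in> set_pmf (transcript (distance_oracle V E) A)"
    from bspec[OF A(2) E(1)] \<tau> E(2,3) show "E' = E" by auto
  qed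
  define L where "L = ln ?n"
  \<comment> \<open>With at least two vertices, \<open>ln 2 >= 2/3\<close> gives
    \<open>L >= 2/3\<close>. Hence \<open>p <= 3/2 * L <= 9/4 * L^2\<close> and
    \<open>1 <= 9/4 * L^2\<close>, which absorbs every summand of the count and yields the factor
    \<open>9 / 4\<close>.\<close>
  have "2 / 3 \<le> ln (2 :: real)" by (rule ln2_ge_two_thirds)
  moreover have "ln 2 \<le> L" using n by (simp add: L_def)
  ultimately have L: "2 / 3 \<le> L" by linarith
  have "2 ^ p \<le> ?n" using p(1) by (metis of_nat_le_iff of_nat_numeral of_nat_power)
  then have "ln (2 ^ p) \<le> L" unfolding L_def using n by (subst ln_le_cancel_iff) auto
  then have "real p * ln 2 \<le> L" by (simp add: ln_realpow)
  moreover have "real p * (2 / 3) \<le> real p * ln 2"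
    by (rule mult_left_mono) (use ln2_ge_two_thirds in auto)
  ultimately have pL: "real p \<le> 3 / 2 * L" by linarith
  have LL: "3 / 2 * L \<le> 9 / 4 * L\<^sup>2"
    using L mult_mono[of "2 / 3" L L L] by (simp add: power2_eq_square)
  then have one: "1 \<le> 9 / 4 * L\<^sup>2" using L by linarith
  have "1 + ?s * (real p + 1) + ?t \<le> 9 / 4 * L\<^sup>2 + ?s * (9 / 4 * L\<^sup>2 + 9 / 4 * L\<^sup>2) + ?t * (9 / 4 * L\<^sup>2)"
    using one pL LL mult_left_mono[of 1 "9 / 4 * L\<^sup>2" ?t]
    by (intro add_mono mult_left_mono) auto
  also have "\<dots> = 9 / 4 * (1 + 2 * ?s + ?t) * L\<^sup>2" by (simp add: algebra_simps)
  finally have "?n * (1 + ?s * (real p + 1) + ?t) \<le> ?n * (9 / 4 * (1 + 2 * ?s + ?t) * L\<^sup>2)"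
    by (rule mult_left_mono) simp
  moreover have "real ?T = ?n * (1 + ?s * (real p + 1) + ?t)"
    by (simp add: algebra_simps del: power_Suc)
  ultimately have T: "real ?T \<le> 9 / 4 * (1 + 2 * ?s + ?t) * ?n * L\<^sup>2"
    by (simp only: mult_ac)
  have "query_complexity V ?\<G> A \<le> ennreal (real ?T)"
    unfolding query_complexity_def
  proof (rule SUP_least)
    fix E assume "E \<in> ?\<G>"
    from bspec[OF A(2) this] obtain \<tau> where
      "transcript (distance_oracle V E) A = return_pmf \<tau>" "length \<tau> \<le> ?T" by auto
    then have "(\<integral>\<^sup>+ \<tau>. of_nat (length \<tau>) \<partial>measure_pmf (transcript (distance_oracle V E) A))
        = ennreal (real (length \<tau>))"
      by (simp add: ennreal_of_nat_eq_real_of_nat)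
    also have "\<dots> \<le> ennreal (real ?T)"
      by (intro ennreal_leI of_nat_mono \<open>length \<tau> \<le> ?T\<close>)
    finally show "(\<integral>\<^sup>+ \<tau>. of_nat (length \<tau>) \<partial>measure_pmf (transcript (distance_oracle V E) A))
        \<le> ennreal (real ?T)" .
  qed
  also have "\<dots> \<le> ennreal (9 / 4 * (1 + 2 * ?s + ?t) * ?n * L\<^sup>2)"
    by (rule ennreal_leI[OF T])
  finally show ?thesis using A(1) rec unfolding L_def by blast
qed

theorem theorem1:
  "\<exists>(A :: nat \<Rightarrow> nat \<Rightarrow> 'v set \<Rightarrow> ('v \<times> 'v) query_alg) (g :: nat \<Rightarrow> nat \<Rightarrow> real).
     \<forall>\<Delta> k V. finite V \<and> V \<noteq> {} \<longrightarrow>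
       query_set (A \<Delta> k V) \<subseteq> V \<times> V \<and>
       reconstructs V (bounded_treelength_graphs \<Delta> k V) (A \<Delta> k V) \<and>
       query_complexity V (bounded_treelength_graphs \<Delta> k V) (A \<Delta> k V)
         \<le> ennreal (g \<Delta> k * real (card V) * (ln (real (card V)))\<^sup>2)"
proof -
  let ?g = "\<lambda>\<Delta> k. 9 / 4 * (1 + 2 * real (Suc \<Delta> ^ k * Suc \<Delta>) + real (Suc \<Delta> ^ (3 * k + 1)))"
  let ?P = "\<lambda>\<Delta> k (V :: 'v set) A. query_set A \<subseteq> V \<times> V \<and>
    reconstructs V (bounded_treelength_graphs \<Delta> k V) A \<and>
    query_complexity V (bounded_treelength_graphs \<Delta> k V) A
      \<le> ennreal (?g \<Delta> k * real (card V) * (ln (real (card V)))\<^sup>2)"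
  show ?thesis
  proof (intro exI[of _ "\<lambda>\<Delta> k V. SOME A. ?P \<Delta> k V A"] exI[of _ ?g] allI impI)
    fix \<Delta> k and V :: "'v set"
    assume "finite V \<and> V \<noteq> {}"
    then show "?P \<Delta> k V (SOME A. ?P \<Delta> k V A)"
      by (intro someI_ex[of "?P \<Delta> k V"] reconstruction_alg) auto
  qed
qed

end
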